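(* Let $k$ be an arbitrary field and let $G$ be a group with a torsion abelian subgroup $A$. Suppose that $\mathrm{char}(k)\notin\Pi(A)$ and that $G$ admits a faithful irreducible module $V$ over $k$. Then there is a subgroup $C$ of $A$ such that $A/C$ is locally cyclic and $\mathrm{core}_G(C)=1$.
   Context: Groups may be infinite and modules may be infinite dimensional. A $G$-module over $k$ is a left module over the group algebra $kG$; it is faithful if only the identity of $G$ acts trivially, and irreducible if it is nonzero and has no submodules other than $0$ and itself. A group is locally cyclic if every finitely generated subgroup of it is cyclic. For a subgroup $C$ of $G$, $\mathrm{core}_G(C)$ is the largest normal subgroup of $G$ contained in $C$, i.e. $\bigcap_{g\in G} gCg^{-1}$. For a group $H$, $\Pi(H)$ is the set of all primes $p$ such that $a^p=1$ for some $a\in H$, $a\neq 1$. The subgroup $A$ is not assumed to be normal in $G$. *)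

theory Defs
  imports "HOL-Algebra.Algebra"
begin

section \<open>Left modules\<close>

text \<open>The library locale \<^locale>\<open>module\<close> requires a commutative ring of scalars.  Its notion
  \<^locale>\<open>submodule\<close> makes no such assumption and is used below as it stands.\<close>

locale left_module = R?: ring R + M?: abelian_group M
  for R :: "('r, 'm) ring_scheme" (structure) and M :: "('r, 'v, 'n) module_scheme" (structure) +
  assumes smult_closed:
      "\<lbrakk>a \<in> carrier R; x \<in> carrier M\<rbrakk> \<Longrightarrow> a \<odot>\<^bsub>M\<^esub> x \<in> carrier M"
    and smult_l_distr:
      "\<lbrakk>a \<in> carrier R; b \<in> carrier R; x \<in> carrier M\<rbrakk> \<Longrightarrow>
        (a \<oplus> b) \<odot>\<^bsub>M\<^esub> x = a \<odot>\<^bsub>M\<^esub> x \<oplus>\<^bsub>M\<^esub> b \<odot>\<^bsub>M\<^esub> x"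
    and smult_r_distr:
      "\<lbrakk>a \<in> carrier R; x \<in> carrier M; y \<in> carrier M\<rbrakk> \<Longrightarrow>
        a \<odot>\<^bsub>M\<^esub> (x \<oplus>\<^bsub>M\<^esub> y) = a \<odot>\<^bsub>M\<^esub> x \<oplus>\<^bsub>M\<^esub> a \<odot>\<^bsub>M\<^esub> y"
    and smult_assoc1:
      "\<lbrakk>a \<in> carrier R; b \<in> carrier R; x \<in> carrier M\<rbrakk> \<Longrightarrow>
        (a \<otimes> b) \<odot>\<^bsub>M\<^esub> x = a \<odot>\<^bsub>M\<^esub> (b \<odot>\<^bsub>M\<^esub> x)"
    and smult_one: "x \<in> carrier M \<Longrightarrow> \<one> \<odot>\<^bsub>M\<^esub> x = x"

definition irreducible_module ::
    "('r, 'm) ring_scheme \<Rightarrow> ('r, 'v, 'n) module_scheme \<Rightarrow> bool" where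
  "irreducible_module R M \<longleftrightarrow>
     left_module R M \<and> carrier M \<noteq> {\<zero>\<^bsub>M\<^esub>} \<and>
     (\<forall>W. submodule W R M \<longrightarrow> W = {\<zero>\<^bsub>M\<^esub>} \<or> W = carrier M)"

section \<open>The group algebra and its modules\<close>

definition supp :: "('k, 'm) ring_scheme \<Rightarrow> ('g \<Rightarrow> 'k) \<Rightarrow> 'g set" where
  "supp k f = {x. f x \<noteq> \<zero>\<^bsub>k\<^esub>}"

text \<open>An element \<open>\<Sum>g. c\<^sub>g g\<close> of the group algebra is represented by the finitely supported
  function \<open>g \<mapsto> c\<^sub>g\<close>, which is zero outside \<open>carrier G\<close>; multiplication is convolution.\<close>

definition group_algebra ::
    "('k, 'm) ring_scheme \<Rightarrow> ('g, 'n) monoid_scheme \<Rightarrow> ('g \<Rightarrow> 'k) ring" where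
  "group_algebra k G =
    \<lparr>carrier = {f. f \<in> UNIV \<rightarrow> carrier k \<and> supp k f \<subseteq> carrier G \<and> finite (supp k f)},
     monoid.mult = (\<lambda>f h x. \<Oplus>\<^bsub>k\<^esub>y \<in> supp k f. \<Oplus>\<^bsub>k\<^esub>z \<in> {z \<in> supp k h. y \<otimes>\<^bsub>G\<^esub> z = x}. f y \<otimes>\<^bsub>k\<^esub> h z),
     monoid.one = (\<lambda>x. if x = \<one>\<^bsub>G\<^esub> then \<one>\<^bsub>k\<^esub> else \<zero>\<^bsub>k\<^esub>),
     ring.zero = (\<lambda>x. \<zero>\<^bsub>k\<^esub>),
     ring.add = (\<lambda>f h x. f x \<oplus>\<^bsub>k\<^esub> h x)\<rparr>"

text \<open>The group algebra is a ring, so the assumption \<open>ring R\<close> in \<^locale>\<open>left_module\<close> holds for it.\<close>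

lemma (in ring) finsum_swap_product:
  assumes "finite S" "finite T" "\<And>y z. y \<in> S \<Longrightarrow> z \<in> T \<Longrightarrow> F y z \<in> carrier R"
  shows "(\<Oplus>y\<in>S. \<Oplus>z\<in>T. F y z) = (\<Oplus>z\<in>T. \<Oplus>y\<in>S. F y z)"
  using assms(1,3)
proof (induction S)
  case empty
  then show ?case by simp
next
  case (insert a S)
  have "(\<Oplus>z\<in>T. \<Oplus>y\<in>insert a S. F y z) = (\<Oplus>z\<in>T. F a z \<oplus> (\<Oplus>y\<in>S. F y z))"
    using insert by (intro finsum_cong') (auto intro!: finsum_insert finsum_closed a_closed)
  also have "\<dots> = (\<Oplus>z\<in>T. F a z) \<oplus> (\<Oplus>z\<in>T. \<Oplus>y\<in>S. F y z)"
    using insert by (intro finsum_addf) (auto intro!: finsum_closed)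
  finally show ?case
    using insert by (subst finsum_insert) (auto intro!: finsum_closed)
qed

lemma (in ring) group_algebra_mult_eq:
  assumes "finite S" "finite T" "supp R f \<subseteq> S" "supp R h \<subseteq> T"
    and [simp]: "\<And>x. f x \<in> carrier R" "\<And>x. h x \<in> carrier R"
  shows "monoid.mult (group_algebra R G) f h x =
    (\<Oplus>y\<in>S. \<Oplus>z\<in>T. if y \<otimes>\<^bsub>G\<^esub> z = x then f y \<otimes> h z else \<zero>)"
proof -
  have "(\<Oplus>z\<in>{z \<in> supp R h. y \<otimes>\<^bsub>G\<^esub> z = x}. f y \<otimes> h z) =
      (\<Oplus>z\<in>T. if y \<otimes>\<^bsub>G\<^esub> z = x then f y \<otimes> h z else \<zero>)" for y
    using assms by (intro add.finprod_mono_neutral_cong_left) (auto simp: supp_def)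
  then have "monoid.mult (group_algebra R G) f h x =
      (\<Oplus>y\<in>supp R f. \<Oplus>z\<in>T. if y \<otimes>\<^bsub>G\<^esub> z = x then f y \<otimes> h z else \<zero>)"
    by (simp add: group_algebra_def)
  also have "\<dots> = (\<Oplus>y\<in>S. \<Oplus>z\<in>T. if y \<otimes>\<^bsub>G\<^esub> z = x then f y \<otimes> h z else \<zero>)"
    using assms
    by (intro add.finprod_mono_neutral_cong_left)
      (auto simp: supp_def intro!: add.finprod_one_eqI finsum_closed)
  finally show ?thesis .
qed

lemma ring_group_algebra:
  fixes k (structure) and G (structure)
  assumes "ring k" "monoid G"
  shows "ring (group_algebra k G)"
proof -
  interpret k: ring k by fact
  interpret G: monoid G by fact
  let ?A = "group_algebra k G"
  have car: "f \<in> carrier ?A \<longleftrightarrow>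
      (\<forall>x. f x \<in> carrier k) \<and> supp k f \<subseteq> carrier G \<and> finite (supp k f)" for f
    by (auto simp: group_algebra_def)
  have add: "f \<oplus>\<^bsub>?A\<^esub> h = (\<lambda>x. f x \<oplus>\<^bsub>k\<^esub> h x)"
    and zero: "\<zero>\<^bsub>?A\<^esub> = (\<lambda>x. \<zero>\<^bsub>k\<^esub>)"
    and one: "\<one>\<^bsub>?A\<^esub> = (\<lambda>x. if x = \<one>\<^bsub>G\<^esub> then \<one>\<^bsub>k\<^esub> else \<zero>\<^bsub>k\<^esub>)" for f h
    by (simp_all add: group_algebra_def)
  have supp_add: "supp k (\<lambda>x. f x \<oplus>\<^bsub>k\<^esub> h x) \<subseteq> supp k f \<union> supp k h" for f h
    by (auto simp: supp_def)
  have add_closed: "f \<oplus>\<^bsub>?A\<^esub> h \<in> carrier ?A" if "f \<in> carrier ?A" "h \<in> carrier ?A" for f h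
    using that supp_add[of f h] unfolding add car
    by (meson finite_Un finite_subset k.a_closed le_sup_iff order_trans)
  have ab: "abelian_group ?A"
  proof (rule abelian_groupI)
    fix f assume f: "f \<in> carrier ?A"
    have "(\<lambda>x. \<ominus>\<^bsub>k\<^esub> f x) \<in> carrier ?A"
    proof -
      have "supp k (\<lambda>x. \<ominus>\<^bsub>k\<^esub> f x) \<subseteq> supp k f"
        by (auto simp: supp_def)
      then show ?thesis
        using f unfolding car by (meson finite_subset k.a_inv_closed order_trans)
    qed
    moreover have "(\<lambda>x. \<ominus>\<^bsub>k\<^esub> f x) \<oplus>\<^bsub>?A\<^esub> f = \<zero>\<^bsub>?A\<^esub>"
      using f by (auto simp: add zero car k.l_neg)
    ultimately show "\<exists>h\<in>carrier ?A. h \<oplus>\<^bsub>?A\<^esub> f = \<zero>\<^bsub>?A\<^esub>" by blast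
  qed (use add_closed in \<open>auto simp: add zero car k.a_ac\<close>, auto simp: supp_def)
  have mult_eq: "(f \<otimes>\<^bsub>?A\<^esub> h) x =
      (\<Oplus>\<^bsub>k\<^esub>y\<in>S. \<Oplus>\<^bsub>k\<^esub>z\<in>T. if y \<otimes>\<^bsub>G\<^esub> z = x then f y \<otimes>\<^bsub>k\<^esub> h z else \<zero>\<^bsub>k\<^esub>)"
    if "f \<in> carrier ?A" "h \<in> carrier ?A" "finite S" "finite T" "supp k f \<subseteq> S" "supp k h \<subseteq> T"
    for f h S T x
    using that by (intro k.group_algebra_mult_eq) (auto simp: car)
  have supp_mult: "supp k (f \<otimes>\<^bsub>?A\<^esub> h) \<subseteq> (\<lambda>(y, z). y \<otimes>\<^bsub>G\<^esub> z) ` (supp k f \<times> supp k h)"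
    if "f \<in> carrier ?A" "h \<in> carrier ?A" for f h
  proof
    fix x assume x: "x \<in> supp k (f \<otimes>\<^bsub>?A\<^esub> h)"
    show "x \<in> (\<lambda>(y, z). y \<otimes>\<^bsub>G\<^esub> z) ` (supp k f \<times> supp k h)"
    proof (rule ccontr)
      assume "x \<notin> (\<lambda>(y, z). y \<otimes>\<^bsub>G\<^esub> z) ` (supp k f \<times> supp k h)"
      then have "{z \<in> supp k h. y \<otimes>\<^bsub>G\<^esub> z = x} = {}" if "y \<in> supp k f" for y
        using that by auto
      then have "(f \<otimes>\<^bsub>?A\<^esub> h) x = \<zero>\<^bsub>k\<^esub>"
        by (auto simp: group_algebra_def intro!: k.add.finprod_one_eqI)
      with x show False by (simp add: supp_def)
    qed
  qed
  have mult_closed: "f \<otimes>\<^bsub>?A\<^esub> h \<in> carrier ?A"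
    if fh: "f \<in> carrier ?A" "h \<in> carrier ?A" for f h
  proof -
    have "(f \<otimes>\<^bsub>?A\<^esub> h) x \<in> carrier k" for x
      using fh by (subst mult_eq[OF fh _ _ subset_refl subset_refl])
        (auto simp: car intro!: k.finsum_closed)
    moreover have "(\<lambda>(y, z). y \<otimes>\<^bsub>G\<^esub> z) ` (supp k f \<times> supp k h) \<subseteq> carrier G"
      using fh by (auto simp: car)
    moreover have "finite ((\<lambda>(y, z). y \<otimes>\<^bsub>G\<^esub> z) ` (supp k f \<times> supp k h))"
      using fh by (auto simp: car)
    ultimately show ?thesis
      using supp_mult[OF fh] unfolding car by (meson finite_subset order_trans)
  qed
  have supp_one: "supp k \<one>\<^bsub>?A\<^esub> \<subseteq> {\<one>\<^bsub>G\<^esub>}" by (auto simp: supp_def one)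
  have one_closed: "\<one>\<^bsub>?A\<^esub> \<in> carrier ?A"
    using supp_one unfolding car by (auto simp: one intro: finite_subset)
  have delta: "(\<Oplus>\<^bsub>k\<^esub>y\<in>S. if y = x then f y else \<zero>\<^bsub>k\<^esub>) = f x"
    if "f \<in> carrier ?A" "finite S" "supp k f \<subseteq> S" for f S x
  proof (cases "x \<in> S")
    case True
    then show ?thesis
      using that k.finsum_singleton[of x S f] by (auto simp: car eq_commute[of x])
  next
    case False
    then have "(\<Oplus>\<^bsub>k\<^esub>y\<in>S. if y = x then f y else \<zero>\<^bsub>k\<^esub>) = \<zero>\<^bsub>k\<^esub>"
      by (intro k.add.finprod_one_eqI) auto
    moreover have "f x = \<zero>\<^bsub>k\<^esub>" using False that(3) by (auto simp: supp_def)
    ultimately show ?thesis by simp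
  qed
  have funct: "(\<Oplus>\<^bsub>k\<^esub>w\<in>W. (f \<otimes>\<^bsub>?A\<^esub> h) w \<otimes>\<^bsub>k\<^esub> \<phi> w) =
      (\<Oplus>\<^bsub>k\<^esub>y\<in>supp k f. \<Oplus>\<^bsub>k\<^esub>z\<in>supp k h. f y \<otimes>\<^bsub>k\<^esub> h z \<otimes>\<^bsub>k\<^esub> \<phi> (y \<otimes>\<^bsub>G\<^esub> z))"
    if fh: "f \<in> carrier ?A" "h \<in> carrier ?A" and [simp]: "\<And>w. \<phi> w \<in> carrier k"
      and W: "W = (\<lambda>(y, z). y \<otimes>\<^bsub>G\<^esub> z) ` (supp k f \<times> supp k h)" for f h \<phi> W
  proof -
    let ?S = "supp k f" and ?T = "supp k h"
    have fin [simp]: "finite ?S" "finite ?T" "finite W"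
      using fh W by (auto simp: car)
    have [simp]: "f y \<in> carrier k" "h y \<in> carrier k" for y
      using fh by (auto simp: car)
    let ?F = "\<lambda>w y z. if y \<otimes>\<^bsub>G\<^esub> z = w then f y \<otimes>\<^bsub>k\<^esub> h z \<otimes>\<^bsub>k\<^esub> \<phi> w else \<zero>\<^bsub>k\<^esub>"
    have "(f \<otimes>\<^bsub>?A\<^esub> h) w \<otimes>\<^bsub>k\<^esub> \<phi> w = (\<Oplus>\<^bsub>k\<^esub>y\<in>?S. \<Oplus>\<^bsub>k\<^esub>z\<in>?T. ?F w y z)" for w
    proof -
      have "(f \<otimes>\<^bsub>?A\<^esub> h) w \<otimes>\<^bsub>k\<^esub> \<phi> w =
        (\<Oplus>\<^bsub>k\<^esub>y\<in>?S. (\<Oplus>\<^bsub>k\<^esub>z\<in>?T. if y \<otimes>\<^bsub>G\<^esub> z = w then f y \<otimes>\<^bsub>k\<^esub> h z else \<zero>\<^bsub>k\<^esub>) \<otimes>\<^bsub>k\<^esub> \<phi> w)"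
        unfolding mult_eq[OF fh fin(1,2) subset_refl subset_refl]
        by (intro k.finsum_ldistr) (auto intro!: k.finsum_closed)
      also have "\<dots> = (\<Oplus>\<^bsub>k\<^esub>y\<in>?S. \<Oplus>\<^bsub>k\<^esub>z\<in>?T. ?F w y z)"
        by (intro k.finsum_cong' refl, force intro!: k.finsum_closed, subst k.finsum_ldistr)
          (auto intro!: k.finsum_cong')
      finally show ?thesis .
    qed
    then have "(\<Oplus>\<^bsub>k\<^esub>w\<in>W. (f \<otimes>\<^bsub>?A\<^esub> h) w \<otimes>\<^bsub>k\<^esub> \<phi> w) =
        (\<Oplus>\<^bsub>k\<^esub>w\<in>W. \<Oplus>\<^bsub>k\<^esub>y\<in>?S. \<Oplus>\<^bsub>k\<^esub>z\<in>?T. ?F w y z)" by simp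
    also have "\<dots> = (\<Oplus>\<^bsub>k\<^esub>y\<in>?S. \<Oplus>\<^bsub>k\<^esub>w\<in>W. \<Oplus>\<^bsub>k\<^esub>z\<in>?T. ?F w y z)"
      by (intro k.finsum_swap_product) (auto intro!: k.finsum_closed)
    also have "\<dots> = (\<Oplus>\<^bsub>k\<^esub>y\<in>?S. \<Oplus>\<^bsub>k\<^esub>z\<in>?T. f y \<otimes>\<^bsub>k\<^esub> h z \<otimes>\<^bsub>k\<^esub> \<phi> (y \<otimes>\<^bsub>G\<^esub> z))"
    proof (rule k.finsum_cong'[OF refl])
      fix y assume y: "y \<in> ?S"
      have "(\<Oplus>\<^bsub>k\<^esub>w\<in>W. \<Oplus>\<^bsub>k\<^esub>z\<in>?T. ?F w y z) = (\<Oplus>\<^bsub>k\<^esub>z\<in>?T. \<Oplus>\<^bsub>k\<^esub>w\<in>W. ?F w y z)"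
        by (intro k.finsum_swap_product) auto
      also have "\<dots> = (\<Oplus>\<^bsub>k\<^esub>z\<in>?T. f y \<otimes>\<^bsub>k\<^esub> h z \<otimes>\<^bsub>k\<^esub> \<phi> (y \<otimes>\<^bsub>G\<^esub> z))"
      proof (rule k.finsum_cong'[OF refl])
        fix z assume z: "z \<in> ?T"
        show "(\<Oplus>\<^bsub>k\<^esub>w\<in>W. ?F w y z) = f y \<otimes>\<^bsub>k\<^esub> h z \<otimes>\<^bsub>k\<^esub> \<phi> (y \<otimes>\<^bsub>G\<^esub> z)"
          using k.finsum_singleton[of "y \<otimes>\<^bsub>G\<^esub> z" W "\<lambda>w. f y \<otimes>\<^bsub>k\<^esub> h z \<otimes>\<^bsub>k\<^esub> \<phi> w"] y z
          by (auto simp: W)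
      qed auto
      finally show "(\<Oplus>\<^bsub>k\<^esub>w\<in>W. \<Oplus>\<^bsub>k\<^esub>z\<in>?T. ?F w y z) =
        (\<Oplus>\<^bsub>k\<^esub>z\<in>?T. f y \<otimes>\<^bsub>k\<^esub> h z \<otimes>\<^bsub>k\<^esub> \<phi> (y \<otimes>\<^bsub>G\<^esub> z))" .
    qed (auto intro!: k.finsum_closed)
    finally show ?thesis .
  qed
  have assoc: "(f \<otimes>\<^bsub>?A\<^esub> h) \<otimes>\<^bsub>?A\<^esub> g = f \<otimes>\<^bsub>?A\<^esub> (h \<otimes>\<^bsub>?A\<^esub> g)"
    if fhg: "f \<in> carrier ?A" "h \<in> carrier ?A" "g \<in> carrier ?A" for f h g
  proof
    fix x
    let ?S = "supp k f" and ?T = "supp k h" and ?U = "supp k g"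
    let ?ST = "(\<lambda>(y, z). y \<otimes>\<^bsub>G\<^esub> z) ` (?S \<times> ?T)" and ?TU = "(\<lambda>(y, z). y \<otimes>\<^bsub>G\<^esub> z) ` (?T \<times> ?U)"
    have fin [simp]: "finite ?S" "finite ?T" "finite ?U" "finite ?ST" "finite ?TU"
      using fhg by (auto simp: car)
    have val [simp]: "f y \<in> carrier k" "h y \<in> carrier k" "g y \<in> carrier k"
        "(f \<otimes>\<^bsub>?A\<^esub> h) y \<in> carrier k" "(h \<otimes>\<^bsub>?A\<^esub> g) y \<in> carrier k" for y
      using fhg mult_closed[of f h] mult_closed[of h g] by (auto simp: car)
    have inG: "y \<in> ?S \<Longrightarrow> y \<in> carrier G" "y \<in> ?T \<Longrightarrow> y \<in> carrier G" "y \<in> ?U \<Longrightarrow> y \<in> carrier G" for y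
      using fhg by (auto simp: car)
    define tot where "tot = (\<Oplus>\<^bsub>k\<^esub>y\<in>?S. \<Oplus>\<^bsub>k\<^esub>z\<in>?T. \<Oplus>\<^bsub>k\<^esub>u\<in>?U.
      if y \<otimes>\<^bsub>G\<^esub> z \<otimes>\<^bsub>G\<^esub> u = x then f y \<otimes>\<^bsub>k\<^esub> h z \<otimes>\<^bsub>k\<^esub> g u else \<zero>\<^bsub>k\<^esub>)"
    define \<phi> where "\<phi> w = (\<Oplus>\<^bsub>k\<^esub>u\<in>?U. if w \<otimes>\<^bsub>G\<^esub> u = x then g u else \<zero>\<^bsub>k\<^esub>)" for w
    define \<psi> where "\<psi> y v = (if y \<otimes>\<^bsub>G\<^esub> v = x then \<one>\<^bsub>k\<^esub> else \<zero>\<^bsub>k\<^esub>)" for y v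
    have \<phi> [simp]: "\<phi> w \<in> carrier k" for w
      unfolding \<phi>_def by (auto intro!: k.finsum_closed)
    have \<psi> [simp]: "\<psi> y v \<in> carrier k" for y v
      unfolding \<psi>_def by auto
    have pull: "c \<otimes>\<^bsub>k\<^esub> \<phi> w = (\<Oplus>\<^bsub>k\<^esub>u\<in>?U. if w \<otimes>\<^bsub>G\<^esub> u = x then c \<otimes>\<^bsub>k\<^esub> g u else \<zero>\<^bsub>k\<^esub>)"
      if "c \<in> carrier k" for c w
      unfolding \<phi>_def using that by (subst k.finsum_rdistr) (auto intro!: k.finsum_cong')
    have "((f \<otimes>\<^bsub>?A\<^esub> h) \<otimes>\<^bsub>?A\<^esub> g) x = (\<Oplus>\<^bsub>k\<^esub>w\<in>?ST. (f \<otimes>\<^bsub>?A\<^esub> h) w \<otimes>\<^bsub>k\<^esub> \<phi> w)"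
      unfolding mult_eq[OF mult_closed[OF fhg(1,2)] fhg(3) fin(4,3) supp_mult[OF fhg(1,2)] subset_refl]
      by (simp add: pull)
    also have "\<dots> = (\<Oplus>\<^bsub>k\<^esub>y\<in>?S. \<Oplus>\<^bsub>k\<^esub>z\<in>?T. f y \<otimes>\<^bsub>k\<^esub> h z \<otimes>\<^bsub>k\<^esub> \<phi> (y \<otimes>\<^bsub>G\<^esub> z))"
      using fhg by (intro funct) auto
    also have "\<dots> = tot"
      unfolding tot_def by (simp add: pull)
    finally have 1: "((f \<otimes>\<^bsub>?A\<^esub> h) \<otimes>\<^bsub>?A\<^esub> g) x = tot" .
    have "(f \<otimes>\<^bsub>?A\<^esub> (h \<otimes>\<^bsub>?A\<^esub> g)) x =
        (\<Oplus>\<^bsub>k\<^esub>y\<in>?S. f y \<otimes>\<^bsub>k\<^esub> (\<Oplus>\<^bsub>k\<^esub>v\<in>?TU. (h \<otimes>\<^bsub>?A\<^esub> g) v \<otimes>\<^bsub>k\<^esub> \<psi> y v))"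
      unfolding mult_eq[OF fhg(1) mult_closed[OF fhg(2,3)] fin(1,5) subset_refl supp_mult[OF fhg(2,3)]]
      by (subst k.finsum_rdistr)
        (auto intro!: k.finsum_cong' k.finsum_closed simp: \<psi>_def simp del: k.finsum_infinite)
    also have "\<dots> = (\<Oplus>\<^bsub>k\<^esub>y\<in>?S. f y \<otimes>\<^bsub>k\<^esub>
        (\<Oplus>\<^bsub>k\<^esub>z\<in>?T. \<Oplus>\<^bsub>k\<^esub>u\<in>?U. h z \<otimes>\<^bsub>k\<^esub> g u \<otimes>\<^bsub>k\<^esub> \<psi> y (z \<otimes>\<^bsub>G\<^esub> u)))"
      by (subst funct[OF fhg(2,3) \<psi> refl]) simp
    also have "\<dots> = tot"
    proof -
      have "f y \<otimes>\<^bsub>k\<^esub> (\<Oplus>\<^bsub>k\<^esub>z\<in>?T. \<Oplus>\<^bsub>k\<^esub>u\<in>?U. h z \<otimes>\<^bsub>k\<^esub> g u \<otimes>\<^bsub>k\<^esub> \<psi> y (z \<otimes>\<^bsub>G\<^esub> u)) =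
          (\<Oplus>\<^bsub>k\<^esub>z\<in>?T. \<Oplus>\<^bsub>k\<^esub>u\<in>?U.
            if y \<otimes>\<^bsub>G\<^esub> z \<otimes>\<^bsub>G\<^esub> u = x then f y \<otimes>\<^bsub>k\<^esub> h z \<otimes>\<^bsub>k\<^esub> g u else \<zero>\<^bsub>k\<^esub>)" if y: "y \<in> ?S" for y
      proof -
        have "f y \<otimes>\<^bsub>k\<^esub> (\<Oplus>\<^bsub>k\<^esub>z\<in>?T. \<Oplus>\<^bsub>k\<^esub>u\<in>?U. h z \<otimes>\<^bsub>k\<^esub> g u \<otimes>\<^bsub>k\<^esub> \<psi> y (z \<otimes>\<^bsub>G\<^esub> u)) =
          (\<Oplus>\<^bsub>k\<^esub>z\<in>?T. f y \<otimes>\<^bsub>k\<^esub> (\<Oplus>\<^bsub>k\<^esub>u\<in>?U. h z \<otimes>\<^bsub>k\<^esub> g u \<otimes>\<^bsub>k\<^esub> \<psi> y (z \<otimes>\<^bsub>G\<^esub> u)))"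
          by (intro k.finsum_rdistr) (auto intro!: k.finsum_closed)
        also have "\<dots> = (\<Oplus>\<^bsub>k\<^esub>z\<in>?T. \<Oplus>\<^bsub>k\<^esub>u\<in>?U.
            if y \<otimes>\<^bsub>G\<^esub> z \<otimes>\<^bsub>G\<^esub> u = x then f y \<otimes>\<^bsub>k\<^esub> h z \<otimes>\<^bsub>k\<^esub> g u else \<zero>\<^bsub>k\<^esub>)"
          using y
          by (intro k.finsum_cong' refl, force intro!: k.finsum_closed, subst k.finsum_rdistr)
            (auto intro!: k.finsum_cong' simp: \<psi>_def inG k.m_assoc G.m_assoc)
        finally show ?thesis .
      qed
      then show ?thesis
        unfolding tot_def by (intro k.finsum_cong' refl) (auto intro!: k.finsum_closed)
    qed
    finally show "((f \<otimes>\<^bsub>?A\<^esub> h) \<otimes>\<^bsub>?A\<^esub> g) x = (f \<otimes>\<^bsub>?A\<^esub> (h \<otimes>\<^bsub>?A\<^esub> g)) x"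
      using 1 by simp
  qed
  have l_one: "\<one>\<^bsub>?A\<^esub> \<otimes>\<^bsub>?A\<^esub> f = f" and r_one: "f \<otimes>\<^bsub>?A\<^esub> \<one>\<^bsub>?A\<^esub> = f" if f: "f \<in> carrier ?A" for f
  proof -
    have fin [simp]: "finite (supp k f)" and val [simp]: "f y \<in> carrier k" for y
      using f by (auto simp: car)
    have inG: "y \<in> supp k f \<Longrightarrow> y \<in> carrier G" for y
      using f by (auto simp: car)
    have aux: "(\<Oplus>\<^bsub>k\<^esub>z\<in>supp k f. if P z then f z else \<zero>\<^bsub>k\<^esub>) = f x"
      if "\<And>z. z \<in> supp k f \<Longrightarrow> P z \<longleftrightarrow> z = x" for P x
      using delta[OF f fin subset_refl, of x] k.finsum_cong'[of "supp k f" "supp k f"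
        "\<lambda>y. if y = x then f y else \<zero>\<^bsub>k\<^esub>" "\<lambda>z. if P z then f z else \<zero>\<^bsub>k\<^esub>"] that by auto
    have o: "\<one>\<^bsub>?A\<^esub> \<one>\<^bsub>G\<^esub> = \<one>\<^bsub>k\<^esub>" by (simp add: one)
    show "\<one>\<^bsub>?A\<^esub> \<otimes>\<^bsub>?A\<^esub> f = f"
    proof
      fix x
      show "(\<one>\<^bsub>?A\<^esub> \<otimes>\<^bsub>?A\<^esub> f) x = f x"
        unfolding mult_eq[OF one_closed f _ fin supp_one subset_refl, simplified]
        using aux[of "\<lambda>z. \<one>\<^bsub>G\<^esub> \<otimes>\<^bsub>G\<^esub> z = x" x] by (subst k.finsum_insert) (auto simp: o inG cong: if_cong intro!: k.finsum_closed)
    qed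
    show "f \<otimes>\<^bsub>?A\<^esub> \<one>\<^bsub>?A\<^esub> = f"
    proof
      fix x
      show "(f \<otimes>\<^bsub>?A\<^esub> \<one>\<^bsub>?A\<^esub>) x = f x"
        unfolding mult_eq[OF f one_closed fin _ subset_refl supp_one, simplified]
        using aux[of "\<lambda>z. z \<otimes>\<^bsub>G\<^esub> \<one>\<^bsub>G\<^esub> = x" x] by (simp add: o inG cong: if_cong)
    qed
  qed
  have l_distr: "(f \<oplus>\<^bsub>?A\<^esub> h) \<otimes>\<^bsub>?A\<^esub> g = f \<otimes>\<^bsub>?A\<^esub> g \<oplus>\<^bsub>?A\<^esub> h \<otimes>\<^bsub>?A\<^esub> g"
    and r_distr: "g \<otimes>\<^bsub>?A\<^esub> (f \<oplus>\<^bsub>?A\<^esub> h) = g \<otimes>\<^bsub>?A\<^esub> f \<oplus>\<^bsub>?A\<^esub> g \<otimes>\<^bsub>?A\<^esub> h"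
    if fhg: "f \<in> carrier ?A" "h \<in> carrier ?A" "g \<in> carrier ?A" for f h g
  proof -
    let ?S = "supp k f \<union> supp k h" and ?T = "supp k g"
    have fin [simp]: "finite ?S" "finite ?T" and val [simp]: "f y \<in> carrier k"
        "h y \<in> carrier k" "g y \<in> carrier k" for y
      using fhg by (auto simp: car)
    have sub: "supp k (f \<oplus>\<^bsub>?A\<^esub> h) \<subseteq> ?S" unfolding add by (rule supp_add)
    show "(f \<oplus>\<^bsub>?A\<^esub> h) \<otimes>\<^bsub>?A\<^esub> g = f \<otimes>\<^bsub>?A\<^esub> g \<oplus>\<^bsub>?A\<^esub> h \<otimes>\<^bsub>?A\<^esub> g"
    proof
      fix x
      have "((f \<oplus>\<^bsub>?A\<^esub> h) \<otimes>\<^bsub>?A\<^esub> g) x = (\<Oplus>\<^bsub>k\<^esub>y\<in>?S. \<Oplus>\<^bsub>k\<^esub>z\<in>?T.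
          (if y \<otimes>\<^bsub>G\<^esub> z = x then f y \<otimes>\<^bsub>k\<^esub> g z else \<zero>\<^bsub>k\<^esub>) \<oplus>\<^bsub>k\<^esub>
          (if y \<otimes>\<^bsub>G\<^esub> z = x then h y \<otimes>\<^bsub>k\<^esub> g z else \<zero>\<^bsub>k\<^esub>))"
        unfolding mult_eq[OF add_closed[OF fhg(1,2)] fhg(3) fin sub subset_refl]
        by (intro k.finsum_cong' refl) (auto simp: add k.l_distr intro!: k.finsum_cong' k.finsum_closed)
      also have "\<dots> = (f \<otimes>\<^bsub>?A\<^esub> g) x \<oplus>\<^bsub>k\<^esub> (h \<otimes>\<^bsub>?A\<^esub> g) x"
        unfolding mult_eq[OF fhg(1,3) fin Un_upper1 subset_refl] mult_eq[OF fhg(2,3) fin Un_upper2 subset_refl]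
        by (subst k.finsum_addf[symmetric])
          (auto intro!: k.finsum_cong' k.finsum_addf k.finsum_closed)
      finally show "((f \<oplus>\<^bsub>?A\<^esub> h) \<otimes>\<^bsub>?A\<^esub> g) x = (f \<otimes>\<^bsub>?A\<^esub> g \<oplus>\<^bsub>?A\<^esub> h \<otimes>\<^bsub>?A\<^esub> g) x"
        by (simp add: add)
    qed
    show "g \<otimes>\<^bsub>?A\<^esub> (f \<oplus>\<^bsub>?A\<^esub> h) = g \<otimes>\<^bsub>?A\<^esub> f \<oplus>\<^bsub>?A\<^esub> g \<otimes>\<^bsub>?A\<^esub> h"
    proof
      fix x
      have "(g \<otimes>\<^bsub>?A\<^esub> (f \<oplus>\<^bsub>?A\<^esub> h)) x = (\<Oplus>\<^bsub>k\<^esub>y\<in>?T. \<Oplus>\<^bsub>k\<^esub>z\<in>?S.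
          (if y \<otimes>\<^bsub>G\<^esub> z = x then g y \<otimes>\<^bsub>k\<^esub> f z else \<zero>\<^bsub>k\<^esub>) \<oplus>\<^bsub>k\<^esub>
          (if y \<otimes>\<^bsub>G\<^esub> z = x then g y \<otimes>\<^bsub>k\<^esub> h z else \<zero>\<^bsub>k\<^esub>))"
        unfolding mult_eq[OF fhg(3) add_closed[OF fhg(1,2)] fin(2,1) subset_refl sub]
        by (intro k.finsum_cong' refl) (auto simp: add k.r_distr intro!: k.finsum_cong' k.finsum_closed)
      also have "\<dots> = (g \<otimes>\<^bsub>?A\<^esub> f) x \<oplus>\<^bsub>k\<^esub> (g \<otimes>\<^bsub>?A\<^esub> h) x"
        unfolding mult_eq[OF fhg(3,1) fin(2,1) subset_refl Un_upper1] mult_eq[OF fhg(3,2) fin(2,1) subset_refl Un_upper2]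
        by (subst k.finsum_addf[symmetric])
          (auto intro!: k.finsum_cong' k.finsum_addf k.finsum_closed)
      finally show "(g \<otimes>\<^bsub>?A\<^esub> (f \<oplus>\<^bsub>?A\<^esub> h)) x = (g \<otimes>\<^bsub>?A\<^esub> f \<oplus>\<^bsub>?A\<^esub> g \<otimes>\<^bsub>?A\<^esub> h) x"
        by (simp add: add)
    qed
  qed
  show ?thesis
    by (intro ringI ab monoidI mult_closed one_closed assoc l_one r_one l_distr r_distr)
qed

definition group_elem ::
    "('k, 'm) ring_scheme \<Rightarrow> 'g \<Rightarrow> 'g \<Rightarrow> 'k" where
  "group_elem k g = (\<lambda>x. if x = g then \<one>\<^bsub>k\<^esub> else \<zero>\<^bsub>k\<^esub>)"

definition faithful_module ::
    "('k, 'm) ring_scheme \<Rightarrow> ('g, 'n) monoid_scheme \<Rightarrow> ('g \<Rightarrow> 'k, 'v, 'o) module_scheme \<Rightarrow> bool" where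
  "faithful_module k G V \<longleftrightarrow>
     left_module (group_algebra k G) V \<and>
     (\<forall>g \<in> carrier G. (\<forall>v \<in> carrier V. group_elem k g \<odot>\<^bsub>V\<^esub> v = v) \<longrightarrow> g = \<one>\<^bsub>G\<^esub>)"

section \<open>Characteristic\<close>

definition ring_char :: "('k, 'm) ring_scheme \<Rightarrow> nat" where
  "ring_char R =
     (if \<exists>n::nat. n > 0 \<and> [n] \<cdot>\<^bsub>R\<^esub> \<one>\<^bsub>R\<^esub> = \<zero>\<^bsub>R\<^esub> then (LEAST n::nat. n > 0 \<and> [n] \<cdot>\<^bsub>R\<^esub> \<one>\<^bsub>R\<^esub> = \<zero>\<^bsub>R\<^esub>) else 0)"

section \<open>Group theory\<close>

definition torsion_group :: "('g, 'm) monoid_scheme \<Rightarrow> bool" where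
  "torsion_group H \<longleftrightarrow> group H \<and> (\<forall>a \<in> carrier H. \<exists>n::nat. n > 0 \<and> a [^]\<^bsub>H\<^esub> n = \<one>\<^bsub>H\<^esub>)"

definition torsion_primes :: "('g, 'm) monoid_scheme \<Rightarrow> nat set" where
  "torsion_primes H = {p. Factorial_Ring.prime p \<and> (\<exists>a \<in> carrier H. a \<noteq> \<one>\<^bsub>H\<^esub> \<and> a [^]\<^bsub>H\<^esub> p = \<one>\<^bsub>H\<^esub>)}"

definition locally_cyclic :: "('g, 'm) monoid_scheme \<Rightarrow> bool" where
  "locally_cyclic H \<longleftrightarrow>
     group H \<and> (\<forall>S. finite S \<and> S \<subseteq> carrier H \<longrightarrow> cyclic_group (subgroup_generated H S))"

definition normal_core :: "('g, 'm) monoid_scheme \<Rightarrow> 'g set \<Rightarrow> 'g set" where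
  "normal_core G C = (\<Inter>g \<in> carrier G. (g <#\<^bsub>G\<^esub> C) #>\<^bsub>G\<^esub> inv\<^bsub>G\<^esub> g)"

end

theory Submission
  imports Defs
begin

text \<open>
  If \<open>A\<close> and \<open>V\<close> are finite, one can take \<open>C\<close> to be the kernel of the action of \<open>A\<close> on a simple
  \<open>kA\<close>-submodule of \<open>V\<close>.  In general \<open>V\<close> need not have any simple \<open>kA\<close>-submodule, and the proof
  works with a quotient of \<open>V\<close> instead.  Fix \<open>v \<noteq> 0\<close> in \<open>V\<close> and use Zorn's lemma to choose a
  \<open>kA\<close>-submodule \<open>D\<close> of \<open>V\<close> that is maximal subject to \<open>v \<notin> D\<close>
  (lemma \<open>maximal_stable_avoiding\<close>).  Let \<open>C\<close> be the kernel of the action of \<open>A\<close> on \<open>V/D\<close>, that is,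
  the set of \<open>a \<in> A\<close> with \<open>(a - 1)V \<subseteq> D\<close>.

  The core of \<open>C\<close> is trivial (lemma \<open>core_acts_trivially\<close>): let \<open>n\<close> lie in the core.  Each
  conjugate \<open>gng\<^sup>-\<^sup>1\<close> lies in \<open>C\<close>, so \<open>g(n - 1)w = (gng\<^sup>-\<^sup>1 - 1)gw\<close> lies in \<open>D\<close> for all \<open>g\<close> and \<open>w\<close>.
  Hence \<open>(n - 1)V\<close> lies in the largest \<open>G\<close>-submodule inside \<open>D\<close>, which is \<open>0\<close> because \<open>D \<noteq> V\<close> and
  \<open>V\<close> is irreducible.  So \<open>n\<close> acts trivially on \<open>V\<close>, and \<open>n = 1\<close> because \<open>V\<close> is faithful.

  The quotient \<open>A/C\<close> is locally cyclic because, for each prime \<open>p\<close>, it has at most one subgroup of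
  order \<open>p\<close>; for a torsion abelian group this suffices
  (lemma \<open>locally_cyclic_if_unique_prime_order_subgroups\<close>).  Suppose that \<open>x\<close> and \<open>y\<close> generate
  different subgroups of order \<open>p\<close> of \<open>A/C\<close>.  If \<open>z \<in> A\<close> has order \<open>p\<close> modulo \<open>C\<close>, then
  \<open>D + (z - 1)V\<close> is a \<open>kA\<close>-submodule larger than \<open>D\<close>, so it contains \<open>v\<close>; applying
  \<open>N\<^sub>z = 1 + z + \<dots> + z\<^sup>p\<^sup>-\<^sup>1\<close>, which maps \<open>(z - 1)V\<close> into \<open>(z\<^sup>p - 1)V \<subseteq> D\<close>, gives \<open>N\<^sub>z v \<in> D\<close>
  (lemma \<open>norm_in_maximal_stable\<close>).  This holds for all the elements \<open>x y\<^sup>j\<close>, and for \<open>y\<^sup>i\<close> when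
  \<open>0 < i < p\<close>.  But the sum of the norms of \<open>x y\<^sup>j\<close> for \<open>j < p\<close> is \<open>\<Sum>\<^sub>i x\<^sup>i (\<Sum>\<^sub>j y\<^sup>i\<^sup>j)\<close>, in which the term for
  \<open>i = 0\<close> is \<open>p\<close> and the others are multiples of norms of \<open>y\<^sup>i\<close>.  Therefore \<open>p v \<in> D\<close>.  Since \<open>A\<close> is
  torsion and \<open>A/C\<close> has an element of order \<open>p\<close>, so has \<open>A\<close>; hence \<open>p\<close> is invertible in \<open>k\<close> and
  \<open>v \<in> D\<close>, a contradiction (lemma \<open>unique_order_prime_subgroup_mod_kernel\<close>).
\<close>

section \<open>Torsion abelian groups with few elements of prime order\<close>

text \<open>The least \<open>d > 0\<close> with \<open>h\<^sup>d \<in> K\<close> is not \<open>1\<close>, so it is divisible by a prime \<open>p\<close>, and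
  \<open>e = d / p\<close> works.\<close>

lemma (in group) prime_root_outside_subgroup:
  assumes K: "subgroup K G" and h: "h \<in> carrier G" "h \<notin> K" and n: "n > 0" "h [^] (n::nat) \<in> K"
  obtains p e :: nat where "Factorial_Ring.prime p" "h [^] e \<notin> K" "(h [^] e) [^] p \<in> K"
proof -
  define d where "d = (LEAST d::nat. d > 0 \<and> h [^] d \<in> K)"
  have d: "d > 0" "h [^] d \<in> K"
    using LeastI[of "\<lambda>d::nat. d > 0 \<and> h [^] d \<in> K" n] n by (auto simp: d_def)
  have least: "h [^] e \<notin> K" if "0 < e" "e < d" for e :: nat
    using that not_less_Least[of e "\<lambda>d::nat. d > 0 \<and> h [^] d \<in> K"] by (auto simp: d_def)
  have "d \<noteq> 1" using d h by auto
  then obtain p where p: "Factorial_Ring.prime p" "p dvd d"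
    using prime_factor_nat by blast
  then obtain e where e: "d = p * e" by blast
  have "0 < e" "e < d" using d(1) e prime_gt_1_nat[OF p(1)] by auto
  then have "h [^] e \<notin> K" by (rule least)
  moreover have "(h [^] e) [^] p \<in> K"
    using d(2) h(1) by (simp add: nat_pow_pow e mult.commute)
  ultimately show thesis using p(1) that by blast
qed

lemma (in group) subgroup_mem_of_coprime_powers:
  assumes K: "subgroup K G" and y: "y \<in> carrier G" "y [^] (a::nat) \<in> K" "y [^] (b::nat) \<in> K"
    and ab: "coprime a b"
  shows "y \<in> K"
proof -
  interpret K: subgroup K G by fact
  obtain u w where uw: "u * int a + w * int b = 1"
    using bezout_int[of "int a" "int b"] ab coprime_imp_gcd_eq_1[of "int a" "int b"] by auto
  have "y = y [^] (int a * u + int b * w)" using y(1) uw by (simp add: mult.commute)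
  also have "\<dots> = (y [^] a) [^] u \<otimes> (y [^] b) [^] w"
    using y(1) by (simp add: int_pow_mult int_pow_pow[OF y(1), symmetric] int_pow_int)
  also have "\<dots> \<in> K"
    using y(2,3) by (intro K.m_closed subgroup_int_pow_closed[OF K])
  finally show ?thesis .
qed

text \<open>Choose \<open>g\<close> of maximal order and let \<open>K\<close> be the subgroup that it generates; by maximality no cyclic
  subgroup properly contains \<open>K\<close>.  If \<open>K\<close> is not the whole group, some \<open>x \<notin> K\<close> has a prime power
  \<open>x\<^sup>p = g\<^sup>m\<close> in \<open>K\<close>.  If \<open>p\<close> does not divide \<open>m\<close>, then \<open>g\<close> is the
  \<open>p\<close>-th power of an element \<open>t \<notin> K\<close>, and the cyclic subgroup of \<open>t\<close> properly contains \<open>K\<close>.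
  If \<open>p\<close> divides \<open>m\<close>, then \<open>x\<close> can be corrected by an element of \<open>K\<close> to an element \<open>z \<notin> K\<close> of order \<open>p\<close>:
  when \<open>p\<close> divides the order of \<open>g\<close>, this contradicts the uniqueness hypothesis, because \<open>K\<close> has
  elements of order \<open>p\<close> already; otherwise \<open>zg\<close> generates a cyclic subgroup properly containing \<open>K\<close>.\<close>

lemma (in comm_group) cyclic_of_bounded_exponent:
  assumes n: "n > 0" "\<And>x. x \<in> carrier G \<Longrightarrow> x [^] (n::nat) = \<one>"
    and uniq: "\<And>p x y. \<lbrakk>Factorial_Ring.prime (p::nat); x \<in> carrier G; y \<in> carrier G;
        x [^] p = \<one>; y [^] p = \<one>; y \<noteq> \<one>\<rbrakk> \<Longrightarrow> \<exists>i::nat. x = y [^] i"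
  shows "cyclic_group G"
proof -
  have dvd: "ord x dvd n" if "x \<in> carrier G" for x
    using n(2)[OF that] that pow_eq_id by blast
  \<comment> \<open>The bound in the library lemma is strict, hence \<open>Suc n\<close>.\<close>
  have "\<exists>g. g \<in> carrier G \<and> (\<forall>x. x \<in> carrier G \<longrightarrow> ord x \<le> ord g)"
    using dvd n(1) by (intro ex_has_greatest_nat[of _ \<one> _ "Suc n"])
      (auto simp: less_Suc_eq_le intro: dvd_imp_le)
  then obtain g where g: "g \<in> carrier G" and max: "\<And>x. x \<in> carrier G \<Longrightarrow> ord x \<le> ord g"
    by blast
  let ?K = "generate G {g}"
  interpret K: subgroup ?K G using g by (intro generate_is_subgroup) auto
  have gK: "g \<in> ?K" by (simp add: generate.incl)
  have powK: "a [^] (i::int) \<in> ?K" if "a \<in> ?K" for a i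
    using subgroup_int_pow_closed[OF K.subgroup_axioms that] .
  have maximal: "generate G {t} = ?K" if t: "t \<in> carrier G" and gt: "g \<in> generate G {t}" for t
  proof -
    have "finite (generate G {t})"
      using generate_pow_card[OF t] dvd[OF t] n(1) by (metis card.infinite dvd_0_left neq0_conv)
    moreover have "?K \<subseteq> generate G {t}"
      using gt t by (intro generate_subgroup_incl generate_is_subgroup) auto
    moreover have "card (generate G {t}) \<le> card ?K"
      using max[OF t] generate_pow_card[OF t] generate_pow_card[OF g] by simp
    ultimately show ?thesis using card_seteq by blast
  qed
  have "h \<in> ?K" if h0: "h \<in> carrier G" for h
  proof (rule ccontr)
    assume "h \<notin> ?K"
    then obtain p e :: nat where p: "Factorial_Ring.prime p"
        and e: "h [^] e \<notin> ?K" "(h [^] e) [^] p \<in> ?K"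
      using prime_root_outside_subgroup[OF K.subgroup_axioms h0 _ n(1)] n(2)[OF h0] K.one_closed
      by metis
    define x where "x = h [^] e"
    have x: "x \<in> carrier G" "x \<notin> ?K" "x [^] p \<in> ?K" using e h0 by (auto simp: x_def)
    obtain m :: int where m: "x [^] p = g [^] m" using x(3) generate_pow[OF g] by blast
    have primep: "Factorial_Ring.prime (int p)" using p by simp
    show False
    proof (cases "int p dvd m")
      case True
      then obtain m' where m': "m = int p * m'" by blast
      \<comment> \<open>As \<open>x\<^sup>p\<close> has a \<open>p\<close>-th root in \<open>K\<close>, dividing \<open>x\<close> by it leaves an element killed by \<open>p\<close>.\<close>
      define z where "z = x \<otimes> g [^] (- m')"
      have z: "z \<in> carrier G" using x g by (simp add: z_def)
      have "z \<otimes> g [^] m' = x" using x g by (simp add: z_def m_assoc int_pow_neg)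
      then have zK: "z \<notin> ?K" using x(2) powK[OF gK] K.m_closed by metis
      have "z [^] int p = x [^] int p \<otimes> (g [^] (- m')) [^] int p"
        unfolding z_def using x(1) g by (intro int_pow_distrib) auto
      also have "x [^] int p = g [^] m" using m by (simp add: int_pow_int)
      also have "g [^] m \<otimes> (g [^] (- m')) [^] int p = \<one>"
        using g by (simp add: int_pow_pow m' int_pow_mult[symmetric] mult.commute)
      finally have zp: "z [^] p = \<one>" by (simp add: int_pow_int)
      show False
      proof (cases "p dvd ord g")
        case True
        then obtain e where e: "ord g = p * e" by blast
        have "ord g > 0" using dvd[OF g] n(1) by (metis dvd_0_left gr0I)
        then have "e > 0" "e < ord g" using e prime_gt_1_nat[OF p] by auto
        then have "g [^] e \<noteq> \<one>" using pow_eq_id[OF g] nat_dvd_not_less by blast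
        moreover have "(g [^] e) [^] p = \<one>"
          using g e by (simp add: nat_pow_pow mult.commute flip: pow_ord_eq_1)
        ultimately obtain i :: nat where "z = (g [^] e) [^] i"
          using uniq[OF p z _ zp] g by blast
        then have "z = g [^] int (e * i)" using g by (simp add: nat_pow_pow int_pow_int del: of_nat_mult)
        then show False using zK powK[OF gK] by blast
      next
        case False
        then have "coprime (int p) (int (ord g))" using p by (simp add: prime_imp_coprime)
        then obtain u w where uw: "u * int p + w * int (ord g) = 1"
          using bezout_int by (metis coprime_imp_gcd_eq_1)
        \<comment> \<open>As \<open>z\<^sup>p = 1\<close>, \<open>t\<^sup>p = g\<^sup>p\<close>, which generates \<open>K\<close> since \<open>p\<close> is prime to the order of \<open>g\<close>.\<close>
        define t where "t = z \<otimes> g"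
        have t: "t \<in> carrier G" using z g by (simp add: t_def)
        have "t [^] int p = z [^] int p \<otimes> g [^] int p"
          unfolding t_def using z g by (intro int_pow_distrib)
        then have tp: "t [^] int p = g [^] int p" using zp g by (simp add: int_pow_int)
        have "g = g [^] (u * int p + w * int (ord g))" using g uw by simp
        also have "\<dots> = (g [^] int p) [^] u \<otimes> (g [^] int (ord g)) [^] w"
          using g by (simp add: int_pow_mult int_pow_pow mult.commute)
        also have "\<dots> = t [^] (int p * u)"
          using g t tp by (simp add: int_pow_int int_pow_pow[OF t, symmetric])
        finally have "g \<in> generate G {t}" using generate_pow[OF t] by blast
        from maximal[OF t this] have "t \<in> ?K" using generate.incl[of t "{t}"] by auto
        then have "t \<otimes> inv g \<in> ?K" using gK by auto
        then show False using zK z g by (simp add: t_def m_assoc)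
      qed
    next
      case False
      then have "coprime (int p) m" using primep prime_imp_coprime by blast
      then obtain w u where uw: "w * int p + u * m = 1"
        using bezout_int by (metis coprime_imp_gcd_eq_1)
      \<comment> \<open>The Bezout coefficients make \<open>t\<^sup>p = g\<^sup>m\<^sup>u\<^sup>+\<^sup>p\<^sup>w = g\<close>.\<close>
      define t where "t = x [^] u \<otimes> g [^] w"
      have t: "t \<in> carrier G" using x g by (simp add: t_def)
      have xm: "x [^] int p = g [^] m" using m by (simp add: int_pow_int)
      have "t [^] int p = (x [^] u) [^] int p \<otimes> (g [^] w) [^] int p"
        unfolding t_def using x g by (intro int_pow_distrib) auto
      also have "(x [^] u) [^] int p = g [^] (u * m)"
        using x(1) g xm by (simp add: int_pow_pow mult.commute) (metis int_pow_pow mult.commute)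
      also have "g [^] (u * m) \<otimes> (g [^] w) [^] int p = g"
        using g uw by (simp add: int_pow_pow int_pow_mult[symmetric] add.commute)
      finally have "g \<in> generate G {t}" using generate_pow[OF t] by blast
      from maximal[OF t this] have "t \<in> ?K" using generate.incl[of t "{t}"] by auto
      then have "t \<otimes> inv (g [^] w) \<in> ?K" using powK[OF gK] by auto
      then have xu: "x [^] u \<in> ?K" using x g by (simp add: t_def m_assoc)
      have "x = x [^] (u * m + int p * w)" using x uw by (simp add: ac_simps)
      also have "\<dots> = (x [^] u) [^] m \<otimes> (x [^] int p) [^] w"
        using x by (simp add: int_pow_mult int_pow_pow)
      also have "\<dots> \<in> ?K" using powK[OF xu] powK[OF x(3)] by (simp add: int_pow_int)
      finally show False using x(2) by simp
    qed
  qed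
  then have "carrier G = ?K" using K.subset by blast
  then have "carrier G = range (\<lambda>i::int. g [^] i)"
    by (simp add: generate_pow[OF g] full_SetCompr_eq)
  then show ?thesis unfolding cyclic_group by (rule bexI[OF _ g])
qed

text \<open>A finite set \<open>S\<close> generates a group whose exponent divides the product of the orders of its
  elements, so the preceding lemma applies to it.\<close>

lemma (in comm_group) locally_cyclic_if_unique_prime_order_subgroups:
  assumes tors: "torsion_group G"
    and uniq: "\<And>p x y. \<lbrakk>Factorial_Ring.prime (p::nat); x \<in> carrier G; y \<in> carrier G;
        x [^] p = \<one>; y [^] p = \<one>; y \<noteq> \<one>\<rbrakk> \<Longrightarrow> \<exists>i::nat. x = y [^] i"
  shows "locally_cyclic G"
  unfolding locally_cyclic_def
proof (intro conjI allI impI)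
  show "group G" by (rule is_group)
  fix S assume S: "finite S \<and> S \<subseteq> carrier G"
  let ?H = "subgroup_generated G S"
  define n where "n = (\<Prod>s\<in>S. ord s)"
  have "ord s > 0" if "s \<in> carrier G" for s
    using tors that pow_eq_id[OF that] unfolding torsion_group_def by (metis dvd_0_left gr0I)
  then have n: "n > 0" using S by (auto simp: n_def intro!: prod_pos)
  have sub: "subgroup {x \<in> carrier G. x [^] n = \<one>} G"
    by (rule subgroupI) (auto simp: nat_pow_distrib nat_pow_inv)
  have gen: "S \<subseteq> {x \<in> carrier G. x [^] n = \<one>}"
    using S pow_eq_id by (auto simp: n_def)
  have car: "carrier ?H \<subseteq> {x \<in> carrier G. x [^] n = \<one>}"
    using subgroup_generated_minimal[OF sub gen] .
  interpret H: comm_group ?H using abelian_subgroup_generated comm_group_axioms by blast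
  show "cyclic_group ?H"
    using n car uniq by (intro H.cyclic_of_bounded_exponent[of n]) (auto simp: pow_subgroup_generated subset_iff)
qed

section \<open>Torsion primes and the characteristic\<close>

text \<open>If \<open>p\<close> did not divide the order of \<open>y\<close>, then \<open>y\<close> would be a power of \<open>y\<^sup>p\<close> and lie in \<open>K\<close>.
  The lemma carries primes dividing orders of elements of a quotient of \<open>H\<close> back to \<open>H\<close>.\<close>

lemma torsion_prime_of_prime_root:
  assumes tors: "torsion_group H" and K: "subgroup K H" and p: "Factorial_Ring.prime (p::nat)"
    and y: "y \<in> carrier H" "y \<notin> K" "y [^]\<^bsub>H\<^esub> p \<in> K"
  shows "p \<in> torsion_primes H"
proof -
  interpret H: group H using tors by (simp add: torsion_group_def)
  interpret K: subgroup K H by fact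
  have "H.ord y > 0"
    using tors y(1) H.pow_eq_id[OF y(1)] unfolding torsion_group_def by (metis dvd_0_left gr0I)
  moreover have "p dvd H.ord y"
  proof (rule ccontr)
    assume "\<not> p dvd H.ord y"
    then have "coprime p (H.ord y)" using p prime_imp_coprime by blast
    moreover have "y [^]\<^bsub>H\<^esub> H.ord y \<in> K" using y(1) by simp
    ultimately show False using H.subgroup_mem_of_coprime_powers[OF K y(1,3)] y(2) by blast
  qed
  then obtain e where e: "H.ord y = p * e" by blast
  ultimately have "e > 0" "e < H.ord y" using prime_gt_1_nat[OF p] by auto
  then have "y [^]\<^bsub>H\<^esub> e \<noteq> \<one>\<^bsub>H\<^esub>" using H.pow_eq_id[OF y(1)] nat_dvd_not_less by blast
  moreover have "(y [^]\<^bsub>H\<^esub> e) [^]\<^bsub>H\<^esub> p = \<one>\<^bsub>H\<^esub>"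
    using y(1) H.pow_ord_eq_1[OF y(1)] by (simp add: H.nat_pow_pow e mult.commute)
  ultimately show ?thesis using p y(1) by (auto simp: torsion_primes_def)
qed

text \<open>If \<open>p\<close> annihilates \<open>1\<close>, then the additive order of \<open>1\<close> is \<open>p\<close>, which makes \<open>p\<close> the
  characteristic.\<close>

lemma (in domain) prime_not_ring_char:
  assumes p: "Factorial_Ring.prime (p::nat)" and ch: "ring_char R \<noteq> p"
  shows "add_pow R p \<one> \<noteq> \<zero>"
proof
  assume z: "add_pow R p \<one> = \<zero>"
  have iff: "add_pow R n \<one> = \<zero> \<longleftrightarrow> add.ord \<one> dvd n" for n :: nat
    using add.pow_eq_id[of \<one> n] by simp
  have "add.ord \<one> \<noteq> 1" using iff[of 1] by simp
  then have "add.ord \<one> = p" using iff[of p] z p by (auto simp: prime_nat_iff)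
  then have "add_pow R n \<one> = \<zero> \<longleftrightarrow> p dvd n" for n :: nat using iff by simp
  moreover have "(LEAST n::nat. n > 0 \<and> p dvd n) = p"
    using prime_gt_0_nat[OF p] by (intro Least_equality) (auto dest: dvd_imp_le)
  ultimately have "ring_char R = p"
    using prime_gt_0_nat[OF p] by (auto simp: ring_char_def)
  then show False using ch by simp
qed

section \<open>The normal core\<close>

lemma (in group) normal_core_subset:
  assumes C: "C \<subseteq> carrier G"
  shows "normal_core G C \<subseteq> C"
proof
  fix n assume "n \<in> normal_core G C"
  then have "n \<in> (\<one> <# C) #> inv \<one>" unfolding normal_core_def by blast
  then obtain a where "a \<in> C" "n = \<one> \<otimes> a \<otimes> inv \<one>" unfolding l_coset_def r_coset_def by blast
  then show "n \<in> C" using C by auto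
qed

text \<open>The conjugate of \<open>n\<close> by \<open>g\<close> lies in \<open>C\<close> because \<open>n\<close> lies in \<open>hCh\<^sup>-\<^sup>1\<close> for \<open>h\<close> the
  inverse of \<open>g\<close>.\<close>

lemma (in group) normal_core_conj:
  assumes C: "C \<subseteq> carrier G" and n: "n \<in> normal_core G C" and g: "g \<in> carrier G"
  shows "g \<otimes> n \<otimes> inv g \<in> C"
proof -
  have "n \<in> (inv g <# C) #> inv (inv g)"
    using n inv_closed[OF g] unfolding normal_core_def by blast
  then obtain a where a: "a \<in> C" "n = inv g \<otimes> a \<otimes> inv (inv g)"
    unfolding l_coset_def r_coset_def by blast
  have "g \<otimes> n \<otimes> inv g = a"
    using g a(1) C by (simp add: a(2) m_assoc subset_iff) (simp add: m_assoc[symmetric])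
  then show ?thesis using a(1) by simp
qed

lemma (in group) one_in_normal_core:
  assumes "\<one> \<in> C"
  shows "\<one> \<in> normal_core G C"
  unfolding normal_core_def l_coset_def r_coset_def
proof (rule INT_I)
  fix g assume "g \<in> carrier G"
  then have "\<one> = g \<otimes> \<one> \<otimes> inv g" by simp
  then show "\<one> \<in> (\<Union>h\<in>\<Union>h\<in>C. {g \<otimes> h}. {h \<otimes> inv g})" using assms by blast
qed

section \<open>Sums and differences in abelian groups\<close>

lemma (in abelian_monoid) finsum_swap:
  assumes "finite S" "finite T" "\<And>y z. y \<in> S \<Longrightarrow> z \<in> T \<Longrightarrow> F y z \<in> carrier G"
  shows "(\<Oplus>y\<in>S. \<Oplus>z\<in>T. F y z) = (\<Oplus>z\<in>T. \<Oplus>y\<in>S. F y z)"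
  using assms(1,3)
proof (induction S)
  case empty
  then show ?case by simp
next
  case (insert a S)
  have "(\<Oplus>z\<in>T. \<Oplus>y\<in>insert a S. F y z) = (\<Oplus>z\<in>T. F a z \<oplus> (\<Oplus>y\<in>S. F y z))"
    using insert by (intro finsum_cong') (auto intro!: finsum_insert finsum_closed a_closed)
  also have "\<dots> = (\<Oplus>z\<in>T. F a z) \<oplus> (\<Oplus>z\<in>T. \<Oplus>y\<in>S. F y z)"
    using insert by (intro finsum_addf) (auto intro!: finsum_closed)
  finally show ?case
    using insert by (subst finsum_insert) (auto intro!: finsum_closed)
qed

lemma (in abelian_group) a_minus_zero: "\<ominus> \<zero> = \<zero>"
  by (rule minus_equality) auto

lemma (in abelian_group) a_minus_eq_zero: "\<lbrakk>a \<in> carrier G; b \<in> carrier G; a \<ominus> b = \<zero>\<rbrakk> \<Longrightarrow> a = b"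
  by (metis minus_equality minus_minus add.inv_closed a_inv_def a_minus_def)

lemma (in abelian_group) a_minus_split:
  "\<lbrakk>a \<in> carrier G; b \<in> carrier G; c \<in> carrier G\<rbrakk> \<Longrightarrow>
    a \<ominus> c = (a \<ominus> b) \<oplus> (b \<ominus> c)"
  by (simp add: a_minus_def a_assoc r_neg1)

text \<open>The step of the telescoping sum in lemma \<open>norm_in_maximal_stable\<close>: there \<open>b\<close>, \<open>c\<close> and \<open>e\<close> are two
  consecutive translates of a vector and the vector itself.\<close>

lemma (in abelian_group) a_minus_telescope:
  assumes "a \<in> carrier G" "b \<in> carrier G" "c \<in> carrier G" "d \<in> carrier G" "e \<in> carrier G"
  shows "(a \<oplus> (b \<ominus> c)) \<oplus> d \<ominus> (b \<ominus> e) = a \<oplus> (d \<ominus> (c \<ominus> e))"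
proof -
  have "(a \<oplus> (b \<ominus> c)) \<oplus> d \<ominus> (b \<ominus> e) =
      (b \<oplus> \<ominus> b) \<oplus> (a \<oplus> (d \<ominus> (c \<ominus> e)))"
    using assms by (simp add: a_minus_def minus_add a_ac)
  then show ?thesis using assms by (simp add: r_neg)
qed

section \<open>The group action on a module over the group algebra\<close>

definition monomial :: "('k, 'm) ring_scheme \<Rightarrow> 'k \<Rightarrow> 'g \<Rightarrow> 'g \<Rightarrow> 'k" where
  "monomial k c g = (\<lambda>x. if x = g then c else \<zero>\<^bsub>k\<^esub>)"

locale group_algebra_module = k: field k + G: group G + V: left_module "group_algebra k G" V
  for k :: "('k, 'm) ring_scheme" and G :: "('g, 'n) monoid_scheme"
    and V :: "('g \<Rightarrow> 'k, 'v, 'o) module_scheme"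
begin

abbreviation act :: "'k \<Rightarrow> 'g \<Rightarrow> 'v \<Rightarrow> 'v" where
  "act c g w \<equiv> monomial k c g \<odot>\<^bsub>V\<^esub> w"

abbreviation gact :: "'g \<Rightarrow> 'v \<Rightarrow> 'v" where
  "gact g w \<equiv> act \<one>\<^bsub>k\<^esub> g w"

lemma carrier_group_algebra:
  "f \<in> carrier (group_algebra k G) \<longleftrightarrow>
    (\<forall>x. f x \<in> carrier k) \<and> supp k f \<subseteq> carrier G \<and> finite (supp k f)"
  by (auto simp: group_algebra_def)

lemma supp_monomial: "supp k (monomial k c g) \<subseteq> {g}"
  by (auto simp: supp_def monomial_def)

lemma monomial_closed [simp]:
  assumes "c \<in> carrier k" "g \<in> carrier G"
  shows "monomial k c g \<in> carrier (group_algebra k G)"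
  using assms supp_monomial[of c g] finite_subset[OF supp_monomial[of c g]]
  by (auto simp: carrier_group_algebra monomial_def)

lemma monomial_mult:
  assumes "c \<in> carrier k" "d \<in> carrier k" "g \<in> carrier G" "h \<in> carrier G"
  shows "monomial k c g \<otimes>\<^bsub>group_algebra k G\<^esub> monomial k d h = monomial k (c \<otimes>\<^bsub>k\<^esub> d) (g \<otimes>\<^bsub>G\<^esub> h)"
proof
  fix x
  show "(monomial k c g \<otimes>\<^bsub>group_algebra k G\<^esub> monomial k d h) x =
      monomial k (c \<otimes>\<^bsub>k\<^esub> d) (g \<otimes>\<^bsub>G\<^esub> h) x"
    using assms by (subst k.group_algebra_mult_eq[OF _ _ supp_monomial supp_monomial])
      (auto simp: monomial_def k.add.finprod_empty)
qed

lemma act_closed [simp]: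
  "\<lbrakk>c \<in> carrier k; g \<in> carrier G; w \<in> carrier V\<rbrakk> \<Longrightarrow> act c g w \<in> carrier V"
  by (intro V.smult_closed monomial_closed)

lemma act_act:
  assumes "c \<in> carrier k" "d \<in> carrier k" "g \<in> carrier G" "h \<in> carrier G" "w \<in> carrier V"
  shows "act c g (act d h w) = act (c \<otimes>\<^bsub>k\<^esub> d) (g \<otimes>\<^bsub>G\<^esub> h) w"
  using assms by (simp add: V.smult_assoc1[symmetric] monomial_mult)

lemma act_one [simp]: "w \<in> carrier V \<Longrightarrow> gact \<one>\<^bsub>G\<^esub> w = w"
  using V.smult_one[of w] by (simp add: group_algebra_def monomial_def)

lemma act_add:
  "\<lbrakk>c \<in> carrier k; g \<in> carrier G; w \<in> carrier V; u \<in> carrier V\<rbrakk> \<Longrightarrow>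
    act c g (w \<oplus>\<^bsub>V\<^esub> u) = act c g w \<oplus>\<^bsub>V\<^esub> act c g u"
  by (intro V.smult_r_distr monomial_closed)

lemma act_zero [simp]:
  assumes "c \<in> carrier k" "g \<in> carrier G"
  shows "act c g \<zero>\<^bsub>V\<^esub> = \<zero>\<^bsub>V\<^esub>"
proof -
  have "act c g \<zero>\<^bsub>V\<^esub> \<oplus>\<^bsub>V\<^esub> act c g \<zero>\<^bsub>V\<^esub> = act c g \<zero>\<^bsub>V\<^esub>"
    using assms act_add[of c g "\<zero>\<^bsub>V\<^esub>" "\<zero>\<^bsub>V\<^esub>"] by simp
  then show ?thesis using assms by (simp add: V.add.l_cancel_one)
qed

lemma act_neg:
  assumes "c \<in> carrier k" "g \<in> carrier G" "w \<in> carrier V"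
  shows "act c g (\<ominus>\<^bsub>V\<^esub> w) = \<ominus>\<^bsub>V\<^esub> act c g w"
proof -
  have "act c g (\<ominus>\<^bsub>V\<^esub> w) \<oplus>\<^bsub>V\<^esub> act c g w = \<zero>\<^bsub>V\<^esub>"
    using assms by (simp add: act_add[symmetric] V.l_neg)
  then show ?thesis using assms by (simp add: V.minus_equality)
qed

lemma act_minus:
  assumes "c \<in> carrier k" "g \<in> carrier G" "w \<in> carrier V" "u \<in> carrier V"
  shows "act c g (w \<ominus>\<^bsub>V\<^esub> u) = act c g w \<ominus>\<^bsub>V\<^esub> act c g u"
  using assms by (simp add: a_minus_def act_add act_neg)

lemma act_finsum:
  assumes "c \<in> carrier k" "g \<in> carrier G" "finite I" "w \<in> I \<rightarrow> carrier V"
  shows "act c g (\<Oplus>\<^bsub>V\<^esub>i\<in>I. w i) = (\<Oplus>\<^bsub>V\<^esub>i\<in>I. act c g (w i))"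
  using assms(3,4)
proof (induction I)
  case (insert i I)
  then show ?case using assms(1,2) by (simp add: act_add V.finsum_closed Pi_def)
qed (use assms(1,2) in simp)

lemma act_scalar_add:
  assumes "c \<in> carrier k" "d \<in> carrier k" "g \<in> carrier G" "w \<in> carrier V"
  shows "act (c \<oplus>\<^bsub>k\<^esub> d) g w = act c g w \<oplus>\<^bsub>V\<^esub> act d g w"
proof -
  have "monomial k (c \<oplus>\<^bsub>k\<^esub> d) g = monomial k c g \<oplus>\<^bsub>group_algebra k G\<^esub> monomial k d g"
    by (auto simp: monomial_def group_algebra_def)
  then show ?thesis using assms V.smult_l_distr[of "monomial k c g" "monomial k d g" w] by simp
qed

lemma act_scalar_zero [simp]:
  assumes "g \<in> carrier G" "w \<in> carrier V"
  shows "act \<zero>\<^bsub>k\<^esub> g w = \<zero>\<^bsub>V\<^esub>"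
proof -
  have "act \<zero>\<^bsub>k\<^esub> g w \<oplus>\<^bsub>V\<^esub> act \<zero>\<^bsub>k\<^esub> g w = act \<zero>\<^bsub>k\<^esub> g w"
    using assms act_scalar_add[of "\<zero>\<^bsub>k\<^esub>" "\<zero>\<^bsub>k\<^esub>" g w] by simp
  then show ?thesis using assms by (simp add: V.add.l_cancel_one)
qed

lemma act_nat_scalar:
  assumes "w \<in> carrier V"
  shows "act (add_pow k (n::nat) \<one>\<^bsub>k\<^esub>) \<one>\<^bsub>G\<^esub> w = add_pow V n w"
  by (induction n) (use assms in \<open>auto simp: act_scalar_add\<close>)

text \<open>The \<open>kA\<close>-submodules of \<open>V\<close>.  Closure is stated for scalar multiples of single elements of \<open>A\<close>,
  which are already elements of the group algebra of \<open>G\<close>.\<close>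

definition stable_subspace :: "'g set \<Rightarrow> 'v set \<Rightarrow> bool" where
  "stable_subspace A D \<longleftrightarrow> subgroup D (add_monoid V) \<and>
     (\<forall>c \<in> carrier k. \<forall>a \<in> A. \<forall>w \<in> D. act c a w \<in> D)"

text \<open>Closure under negation follows from the action of the scalar \<open>-1\<close>.\<close>

lemma stableI:
  assumes "D \<subseteq> carrier V" "\<zero>\<^bsub>V\<^esub> \<in> D" "\<And>w u. w \<in> D \<Longrightarrow> u \<in> D \<Longrightarrow> w \<oplus>\<^bsub>V\<^esub> u \<in> D"
    and A: "A \<subseteq> carrier G" "\<one>\<^bsub>G\<^esub> \<in> A"
    and act: "\<And>c a w. c \<in> carrier k \<Longrightarrow> a \<in> A \<Longrightarrow> w \<in> D \<Longrightarrow> act c a w \<in> D"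
  shows "stable_subspace A D"
proof -
  have "\<ominus>\<^bsub>V\<^esub> w \<in> D" if w: "w \<in> D" for w
  proof -
    have wV: "w \<in> carrier V" using assms(1) w by auto
    have "act (\<ominus>\<^bsub>k\<^esub> \<one>\<^bsub>k\<^esub>) \<one>\<^bsub>G\<^esub> w \<oplus>\<^bsub>V\<^esub> w = \<zero>\<^bsub>V\<^esub>"
      using wV act_scalar_add[of "\<ominus>\<^bsub>k\<^esub> \<one>\<^bsub>k\<^esub>" "\<one>\<^bsub>k\<^esub>" "\<one>\<^bsub>G\<^esub>" w] by (simp add: k.l_neg)
    then have "\<ominus>\<^bsub>V\<^esub> w = act (\<ominus>\<^bsub>k\<^esub> \<one>\<^bsub>k\<^esub>) \<one>\<^bsub>G\<^esub> w"
      using wV by (simp add: V.minus_equality)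
    then show ?thesis using act A(2) w by simp
  qed
  then have "subgroup D (add_monoid V)"
    using assms(1-3) V.add.subgroupI[of D] by (auto simp: a_inv_def)
  then show ?thesis using act by (auto simp: stable_subspace_def)
qed

lemma stable_subset: "stable_subspace A D \<Longrightarrow> D \<subseteq> carrier V"
  and stable_zero: "stable_subspace A D \<Longrightarrow> \<zero>\<^bsub>V\<^esub> \<in> D"
  and stable_add: "stable_subspace A D \<Longrightarrow> w \<in> D \<Longrightarrow> u \<in> D \<Longrightarrow> w \<oplus>\<^bsub>V\<^esub> u \<in> D"
  and stable_act: "stable_subspace A D \<Longrightarrow> c \<in> carrier k \<Longrightarrow> a \<in> A \<Longrightarrow> w \<in> D \<Longrightarrow> act c a w \<in> D"
  using subgroup.subset[of D "add_monoid V"] subgroup.one_closed[of D "add_monoid V"]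
    subgroup.m_closed[of D "add_monoid V"] by (auto simp: stable_subspace_def)

lemma stable_neg: "stable_subspace A D \<Longrightarrow> w \<in> D \<Longrightarrow> \<ominus>\<^bsub>V\<^esub> w \<in> D"
  using subgroup.m_inv_closed[of D "add_monoid V"] by (auto simp: stable_subspace_def a_inv_def)

lemma stable_minus: "stable_subspace A D \<Longrightarrow> w \<in> D \<Longrightarrow> u \<in> D \<Longrightarrow> w \<ominus>\<^bsub>V\<^esub> u \<in> D"
  by (simp add: a_minus_def stable_add stable_neg)

lemma stable_finsum:
  assumes D: "stable_subspace A D" and "finite I" "\<And>i. i \<in> I \<Longrightarrow> w i \<in> D"
  shows "(\<Oplus>\<^bsub>V\<^esub>i\<in>I. w i) \<in> D"
  using assms(2,3)
proof (induction I)
  case empty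
  then show ?case using stable_zero[OF D] by simp
next
  case (insert i I)
  then show ?case using stable_subset[OF D] by (subst V.finsum_insert) (auto intro: stable_add[OF D])
qed

text \<open>Every element of the group algebra is a finite sum of multiples of group elements; the proof
  splits off one element of the support at a time.\<close>

lemma stable_carrier_imp_submodule:
  assumes D: "stable_subspace (carrier G) D"
  shows "submodule D (group_algebra k G) V"
proof -
  have "f \<odot>\<^bsub>V\<^esub> w \<in> D" if f: "f \<in> carrier (group_algebra k G)" and w: "w \<in> D" for f w
  proof -
    have wV: "w \<in> carrier V" using w stable_subset[OF D] by auto
    have "\<forall>f \<in> carrier (group_algebra k G). supp k f \<subseteq> S \<longrightarrow> f \<odot>\<^bsub>V\<^esub> w \<in> D"
      if "finite S" "S \<subseteq> carrier G" for S
      using that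
    proof (induction S)
      case empty
      show ?case
      proof (intro ballI impI)
        fix f assume f: "f \<in> carrier (group_algebra k G)" "supp k f \<subseteq> {}"
        then have "f = monomial k \<zero>\<^bsub>k\<^esub> \<one>\<^bsub>G\<^esub>" by (auto simp: supp_def monomial_def)
        then show "f \<odot>\<^bsub>V\<^esub> w \<in> D" using wV stable_zero[OF D] by simp
      qed
    next
      case (insert a S)
      show ?case
      proof (intro ballI impI)
        fix f assume f: "f \<in> carrier (group_algebra k G)" "supp k f \<subseteq> insert a S"
        have fk: "f x \<in> carrier k" for x using f by (auto simp: carrier_group_algebra)
        define h where "h = f(a := \<zero>\<^bsub>k\<^esub>)"
        have "supp k h \<subseteq> supp k f" by (auto simp: supp_def h_def)
        then have h: "h \<in> carrier (group_algebra k G)"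
          using f fk finite_subset by (auto simp: carrier_group_algebra h_def)
        have "supp k h \<subseteq> S" using f(2) by (auto simp: supp_def h_def)
        then have hw: "h \<odot>\<^bsub>V\<^esub> w \<in> D" using insert h by auto
        have "f = monomial k (f a) a \<oplus>\<^bsub>group_algebra k G\<^esub> h"
          using fk by (auto simp: monomial_def group_algebra_def h_def)
        then have "f \<odot>\<^bsub>V\<^esub> w = act (f a) a w \<oplus>\<^bsub>V\<^esub> h \<odot>\<^bsub>V\<^esub> w"
          using V.smult_l_distr[of "monomial k (f a) a" h w] insert.prems fk h wV by auto
        then show "f \<odot>\<^bsub>V\<^esub> w \<in> D"
          using hw stable_act[OF D fk _ w] insert.prems by (auto intro: stable_add[OF D])
      qed
    qed
    then show ?thesis using f by (auto simp: carrier_group_algebra)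
  qed
  then show ?thesis
    using D by (auto simp: submodule_def submodule_axioms_def stable_subspace_def)
qed

section \<open>Maximal stable subspaces avoiding a vector\<close>

lemma maximal_stable_avoiding:
  assumes A: "A \<subseteq> carrier G" "\<one>\<^bsub>G\<^esub> \<in> A" and v: "v \<in> carrier V" "v \<noteq> \<zero>\<^bsub>V\<^esub>"
  obtains D where "stable_subspace A D" "v \<notin> D" "\<And>E. \<lbrakk>stable_subspace A E; D \<subseteq> E; v \<notin> E\<rbrakk> \<Longrightarrow> E = D"
proof -
  let ?S = "{D. stable_subspace A D \<and> v \<notin> D}"
  have "stable_subspace A {\<zero>\<^bsub>V\<^esub>}" using A by (intro stableI) auto
  then have "?S \<noteq> {}" using v by blast
  moreover have "\<Union>\<C> \<in> ?S" if ne: "\<C> \<noteq> {}" and chain: "subset.chain ?S \<C>" for \<C>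
  proof -
    have mem: "stable_subspace A D" "v \<notin> D" if "D \<in> \<C>" for D
      using chain that by (auto simp: subset.chain_def)
    have "stable_subspace A (\<Union>\<C>)"
    proof (rule stableI[OF _ _ _ A])
      show "\<Union>\<C> \<subseteq> carrier V" "\<zero>\<^bsub>V\<^esub> \<in> \<Union>\<C>" using mem stable_subset stable_zero ne by blast+
    next
      fix w u assume "w \<in> \<Union>\<C>" "u \<in> \<Union>\<C>"
      then obtain D E where DE: "D \<in> \<C>" "E \<in> \<C>" "w \<in> D" "u \<in> E" by blast
      then have "D \<subseteq> E \<or> E \<subseteq> D" using chain by (auto simp: subset.chain_def)
      then show "w \<oplus>\<^bsub>V\<^esub> u \<in> \<Union>\<C>" using DE mem stable_add by blast
    next
      fix c a w assume "c \<in> carrier k" "a \<in> A" "w \<in> \<Union>\<C>"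
      then show "act c a w \<in> \<Union>\<C>" using mem stable_act by blast
    qed
    then show ?thesis using mem by blast
  qed
  ultimately obtain D where "D \<in> ?S" "\<forall>E\<in>?S. D \<subseteq> E \<longrightarrow> E = D"
    using subset_Zorn_nonempty[of ?S] by blast
  then show thesis using that by blast
qed

definition acts_trivially_mod :: "'v set \<Rightarrow> 'g \<Rightarrow> bool" where
  "acts_trivially_mod D a \<longleftrightarrow> (\<forall>w \<in> carrier V. gact a w \<ominus>\<^bsub>V\<^esub> w \<in> D)"

lemma subgroup_acts_trivially_mod:
  assumes A: "subgroup A G" and D: "stable_subspace A D"
  shows "subgroup {a \<in> A. acts_trivially_mod D a} (G\<lparr>carrier := A\<rparr>)"
proof -
  interpret A: subgroup A G by fact
  interpret GA: group "G\<lparr>carrier := A\<rparr>" using A.subgroup_is_group[OF G.is_group] .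
  have "acts_trivially_mod D \<one>\<^bsub>G\<^esub>"
    using stable_zero[OF D] by (auto simp: acts_trivially_mod_def a_minus_def V.r_neg)
  moreover have "acts_trivially_mod D (a \<otimes>\<^bsub>G\<^esub> b)"
    if "a \<in> A" "b \<in> A" "acts_trivially_mod D a" "acts_trivially_mod D b" for a b
    unfolding acts_trivially_mod_def
  proof
    fix w assume w: "w \<in> carrier V"
    have ab: "a \<in> carrier G" "b \<in> carrier G" using that A.subset by auto
    have "gact (a \<otimes>\<^bsub>G\<^esub> b) w = gact a (gact b w)" using w ab by (simp add: act_act)
    then have "gact (a \<otimes>\<^bsub>G\<^esub> b) w \<ominus>\<^bsub>V\<^esub> w = (gact a (gact b w) \<ominus>\<^bsub>V\<^esub> gact b w) \<oplus>\<^bsub>V\<^esub> (gact b w \<ominus>\<^bsub>V\<^esub> w)"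
      using w ab V.a_minus_split[of "gact a (gact b w)" "gact b w" w] by simp
    then show "gact (a \<otimes>\<^bsub>G\<^esub> b) w \<ominus>\<^bsub>V\<^esub> w \<in> D"
      using that(3,4) w ab by (auto simp: acts_trivially_mod_def intro: stable_add[OF D])
  qed
  moreover have "acts_trivially_mod D (inv\<^bsub>G\<^esub> a)" if "a \<in> A" "acts_trivially_mod D a" for a
    unfolding acts_trivially_mod_def
  proof
    fix w assume w: "w \<in> carrier V"
    have a: "a \<in> carrier G" using that A.subset by auto
    have "gact a (gact (inv\<^bsub>G\<^esub> a) w) = w" using w a by (simp add: act_act)
    then have "gact (inv\<^bsub>G\<^esub> a) w \<ominus>\<^bsub>V\<^esub> w = \<ominus>\<^bsub>V\<^esub> (gact a (gact (inv\<^bsub>G\<^esub> a) w) \<ominus>\<^bsub>V\<^esub> gact (inv\<^bsub>G\<^esub> a) w)"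
      using w a by (simp add: a_minus_def V.minus_add V.a_comm)
    then show "gact (inv\<^bsub>G\<^esub> a) w \<ominus>\<^bsub>V\<^esub> w \<in> D"
      using that(2) w a by (auto simp: acts_trivially_mod_def intro: stable_neg[OF D])
  qed
  ultimately show ?thesis
    using G.m_inv_consistent[OF A]
    by (intro GA.subgroupI) (auto intro: exI[of _ "\<one>\<^bsub>G\<^esub>"])
qed

text \<open>The vectors all of whose \<open>G\<close>-translates lie in \<open>D\<close> form a \<open>G\<close>-submodule other than \<open>V\<close>, which is
  therefore zero.  It contains every \<open>nw - w\<close>, since \<open>g(nw - w) = m(gw) - gw\<close> for the conjugate
  \<open>m = gng\<^sup>-\<^sup>1\<close> of \<open>n\<close>, which acts trivially modulo \<open>D\<close>.\<close>

lemma core_acts_trivially: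
  assumes irr: "irreducible_module (group_algebra k G) V"
    and A: "subgroup A G" and D: "stable_subspace A D" "D \<noteq> carrier V"
    and n: "n \<in> normal_core G {a \<in> A. acts_trivially_mod D a}" and w: "w \<in> carrier V"
  shows "gact n w = w"
proof -
  interpret A: subgroup A G by fact
  have CG: "{a \<in> A. acts_trivially_mod D a} \<subseteq> carrier G" using A.subset by auto
  have conj: "acts_trivially_mod D (g \<otimes>\<^bsub>G\<^esub> n \<otimes>\<^bsub>G\<^esub> inv\<^bsub>G\<^esub> g)" if g: "g \<in> carrier G" for g
    using G.normal_core_conj[OF CG n g] by simp
  have nG: "n \<in> carrier G" using G.normal_core_subset[OF CG] CG n by blast
  \<comment> \<open>The largest \<open>G\<close>-submodule contained in \<open>D\<close>.\<close>
  let ?U = "{u \<in> carrier V. \<forall>g \<in> carrier G. \<forall>c \<in> carrier k. act c g u \<in> D}"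
  have "stable_subspace (carrier G) ?U"
    by (rule stableI) (auto simp: act_add act_act stable_zero[OF D(1)] intro: stable_add[OF D(1)])
  then have "submodule ?U (group_algebra k G) V" by (rule stable_carrier_imp_submodule)
  moreover have "?U \<noteq> carrier V"
  proof
    assume U: "?U = carrier V"
    have "carrier V \<subseteq> D"
    proof
      fix u assume u: "u \<in> carrier V"
      then have "u \<in> ?U" using U by simp
      then have "gact \<one>\<^bsub>G\<^esub> u \<in> D" by blast
      then show "u \<in> D" using u by simp
    qed
    then show False using D stable_subset by blast
  qed
  ultimately have U: "?U = {\<zero>\<^bsub>V\<^esub>}" using irr by (auto simp: irreducible_module_def)
  have "gact n w \<ominus>\<^bsub>V\<^esub> w \<in> ?U"
  proof (intro CollectI conjI ballI)
    show "gact n w \<ominus>\<^bsub>V\<^esub> w \<in> carrier V" using w nG by simp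
    fix g c assume g: "g \<in> carrier G" and c: "c \<in> carrier k"
    let ?m = "g \<otimes>\<^bsub>G\<^esub> n \<otimes>\<^bsub>G\<^esub> inv\<^bsub>G\<^esub> g"
    have "act c g (gact n w \<ominus>\<^bsub>V\<^esub> w) = gact ?m (act c g w) \<ominus>\<^bsub>V\<^esub> act c g w"
      using w nG g c by (simp add: act_minus act_act G.m_assoc)
    then show "act c g (gact n w \<ominus>\<^bsub>V\<^esub> w) \<in> D"
      using conj[OF g] w g c by (simp add: acts_trivially_mod_def)
  qed
  then have "gact n w \<ominus>\<^bsub>V\<^esub> w = \<zero>\<^bsub>V\<^esub>" using U by blast
  then show ?thesis using w nG by (simp add: V.a_minus_eq_zero)
qed

text \<open>As \<open>A\<close> is abelian, \<open>D + (x - 1)V\<close> is again a \<open>kA\<close>-submodule, and it properly contains \<open>D\<close> because \<open>x\<close>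
  acts nontrivially modulo \<open>D\<close>.  By maximality \<open>v = d + (xw - w)\<close> for some \<open>d \<in> D\<close>, and the sum of
  \<open>x\<^sup>i v\<close> for \<open>i < n\<close> telescopes modulo \<open>D\<close> to \<open>x\<^sup>n w - w\<close>, which lies in \<open>D\<close>.\<close>

lemma norm_in_maximal_stable:
  assumes A: "subgroup A G" "comm_group (G\<lparr>carrier := A\<rparr>)"
    and D: "stable_subspace A D" "v \<notin> D" and max: "\<And>E. \<lbrakk>stable_subspace A E; D \<subseteq> E; v \<notin> E\<rbrakk> \<Longrightarrow> E = D"
    and x: "x \<in> A" "\<not> acts_trivially_mod D x" "acts_trivially_mod D (x [^]\<^bsub>G\<^esub> (n::nat))"
  shows "(\<Oplus>\<^bsub>V\<^esub>i\<in>{..<n}. gact (x [^]\<^bsub>G\<^esub> i) v) \<in> D"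
proof -
  interpret A: subgroup A G by fact
  interpret GA: comm_group "G\<lparr>carrier := A\<rparr>" by fact
  have comm: "a \<otimes>\<^bsub>G\<^esub> b = b \<otimes>\<^bsub>G\<^esub> a" if "a \<in> A" "b \<in> A" for a b
    using GA.m_comm[of a b] that by simp
  have xG: "x \<in> carrier G" using x(1) A.subset by auto
  have powA: "x [^]\<^bsub>G\<^esub> (i::nat) \<in> A" for i
    by (induction i) (use x(1) in auto)
  let ?E = "{d \<oplus>\<^bsub>V\<^esub> (gact x w \<ominus>\<^bsub>V\<^esub> w) | d w. d \<in> D \<and> w \<in> carrier V}"
  note DV = subsetD[OF stable_subset[OF D(1)]]
  have E: "stable_subspace A ?E"
  proof (rule stableI[OF _ _ _ A.subset A.one_closed])
    show "?E \<subseteq> carrier V" using DV xG by auto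
    have "\<zero>\<^bsub>V\<^esub> = \<zero>\<^bsub>V\<^esub> \<oplus>\<^bsub>V\<^esub> (gact x \<zero>\<^bsub>V\<^esub> \<ominus>\<^bsub>V\<^esub> \<zero>\<^bsub>V\<^esub>)"
      using xG by (simp add: a_minus_def V.a_minus_zero)
    then show "\<zero>\<^bsub>V\<^esub> \<in> ?E" using stable_zero[OF D(1)] by blast
  next
    fix a b assume "a \<in> ?E" "b \<in> ?E"
    then obtain d e w u where a: "a = d \<oplus>\<^bsub>V\<^esub> (gact x w \<ominus>\<^bsub>V\<^esub> w)" and b: "b = e \<oplus>\<^bsub>V\<^esub> (gact x u \<ominus>\<^bsub>V\<^esub> u)"
      and c: "d \<in> D" "w \<in> carrier V" "e \<in> D" "u \<in> carrier V" by blast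
    have "a \<oplus>\<^bsub>V\<^esub> b = (d \<oplus>\<^bsub>V\<^esub> e) \<oplus>\<^bsub>V\<^esub> (gact x (w \<oplus>\<^bsub>V\<^esub> u) \<ominus>\<^bsub>V\<^esub> (w \<oplus>\<^bsub>V\<^esub> u))"
      unfolding a b using c DV xG by (simp add: act_add a_minus_def V.minus_add V.a_ac)
    then show "a \<oplus>\<^bsub>V\<^esub> b \<in> ?E" using c stable_add[OF D(1)] by blast
  next
    fix c a b assume c: "c \<in> carrier k" and a: "a \<in> A" and "b \<in> ?E"
    then obtain d w where b: "b = d \<oplus>\<^bsub>V\<^esub> (gact x w \<ominus>\<^bsub>V\<^esub> w)" and dw: "d \<in> D" "w \<in> carrier V" by blast
    have aG: "a \<in> carrier G" using a A.subset by auto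
    have dV: "d \<in> carrier V" using DV dw(1) .
    have "act c a (gact x w) = gact x (act c a w)"
      using act_act[of c "\<one>\<^bsub>k\<^esub>" a x w] act_act[of "\<one>\<^bsub>k\<^esub>" c x a w] comm[OF a x(1)] c dw(2) xG aG
      by simp
    then have "act c a b = act c a d \<oplus>\<^bsub>V\<^esub> (gact x (act c a w) \<ominus>\<^bsub>V\<^esub> act c a w)"
      unfolding b using c dw(2) dV xG aG by (simp add: act_add act_minus)
    moreover have "act c a d \<in> D" "act c a w \<in> carrier V"
      using stable_act[OF D(1) c a dw(1)] act_closed[OF c aG dw(2)] .
    ultimately show "act c a b \<in> ?E" by blast
  qed
  have "D \<subseteq> ?E"
  proof
    fix d assume d: "d \<in> D"
    have "d = d \<oplus>\<^bsub>V\<^esub> (gact x \<zero>\<^bsub>V\<^esub> \<ominus>\<^bsub>V\<^esub> \<zero>\<^bsub>V\<^esub>)"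
      using xG DV[OF d] by (simp add: a_minus_def V.a_minus_zero)
    then show "d \<in> ?E" using d by blast
  qed
  moreover have "?E \<noteq> D"
  proof -
    obtain w where w: "w \<in> carrier V" "gact x w \<ominus>\<^bsub>V\<^esub> w \<notin> D"
      using x(2) by (auto simp: acts_trivially_mod_def)
    have "gact x w \<ominus>\<^bsub>V\<^esub> w = \<zero>\<^bsub>V\<^esub> \<oplus>\<^bsub>V\<^esub> (gact x w \<ominus>\<^bsub>V\<^esub> w)" using w xG by simp
    then have "gact x w \<ominus>\<^bsub>V\<^esub> w \<in> ?E" using w stable_zero[OF D(1)] by blast
    then show ?thesis using w by blast
  qed
  ultimately have "v \<in> ?E" using max E by blast
  then obtain d w where v: "v = d \<oplus>\<^bsub>V\<^esub> (gact x w \<ominus>\<^bsub>V\<^esub> w)" and dw: "d \<in> D" "w \<in> carrier V" by blast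
  have tele: "(\<Oplus>\<^bsub>V\<^esub>i\<in>{..<m}. gact (x [^]\<^bsub>G\<^esub> i) v) \<ominus>\<^bsub>V\<^esub> (gact (x [^]\<^bsub>G\<^esub> m) w \<ominus>\<^bsub>V\<^esub> w) \<in> D" for m :: nat
  proof (induction m)
    case 0
    then show ?case using dw stable_zero[OF D(1)] by (simp add: a_minus_def V.r_neg)
  next
    case (Suc m)
    let ?S = "\<Oplus>\<^bsub>V\<^esub>i\<in>{..<m}. gact (x [^]\<^bsub>G\<^esub> i) v" and ?y = "x [^]\<^bsub>G\<^esub> m"
    have vV: "v \<in> carrier V" using v dw DV xG by simp
    have y: "?y \<in> carrier G" using xG by simp
    have SV: "?S \<in> carrier V" using vV xG by (intro V.finsum_closed) auto
    have "(\<Oplus>\<^bsub>V\<^esub>i\<in>{..<Suc m}. gact (x [^]\<^bsub>G\<^esub> i) v) = gact ?y v \<oplus>\<^bsub>V\<^esub> ?S"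
      unfolding lessThan_Suc using vV xG by (subst V.finsum_insert) auto
    also have "gact ?y v = gact ?y d \<oplus>\<^bsub>V\<^esub> (gact (x [^]\<^bsub>G\<^esub> Suc m) w \<ominus>\<^bsub>V\<^esub> gact ?y w)"
      unfolding v using dw DV xG by (simp add: act_add act_minus act_act)
    finally have "(\<Oplus>\<^bsub>V\<^esub>i\<in>{..<Suc m}. gact (x [^]\<^bsub>G\<^esub> i) v) \<ominus>\<^bsub>V\<^esub> (gact (x [^]\<^bsub>G\<^esub> Suc m) w \<ominus>\<^bsub>V\<^esub> w) =
        gact ?y d \<oplus>\<^bsub>V\<^esub> (?S \<ominus>\<^bsub>V\<^esub> (gact ?y w \<ominus>\<^bsub>V\<^esub> w))"
      using dw DV xG SV by (simp add: V.a_minus_telescope)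
    then show ?case
      using Suc stable_act[OF D(1) _ powA dw(1), of "\<one>\<^bsub>k\<^esub>"] by (auto intro: stable_add[OF D(1)])
  qed
  have vV: "v \<in> carrier V" using v dw DV xG by simp
  let ?S = "\<Oplus>\<^bsub>V\<^esub>i\<in>{..<n}. gact (x [^]\<^bsub>G\<^esub> i) v" and ?z = "gact (x [^]\<^bsub>G\<^esub> n) w \<ominus>\<^bsub>V\<^esub> w"
  have "?S \<in> carrier V" using vV xG by (intro V.finsum_closed) auto
  then have "?S = (?S \<ominus>\<^bsub>V\<^esub> ?z) \<oplus>\<^bsub>V\<^esub> ?z"
    using dw xG by (simp add: a_minus_def V.a_assoc V.l_neg)
  moreover have "?z \<in> D" using x(3) dw by (auto simp: acts_trivially_mod_def)
  ultimately show ?thesis using tele[of n] stable_add[OF D(1)] by metis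
qed

text \<open>Suppose that no \<open>x y\<^sup>j\<close> acts trivially modulo \<open>D\<close>, and consider the double sum of
  \<open>(x y\<^sup>j)\<^sup>i v = x\<^sup>i (y\<^sup>i)\<^sup>j v\<close> over \<open>i, j < p\<close>.  For fixed \<open>j\<close> it is the norm of \<open>x y\<^sup>j\<close> applied to \<open>v\<close>.
  For fixed \<open>i > 0\<close> it is \<open>x\<^sup>i\<close> times the norm of \<open>y\<^sup>i\<close> applied to \<open>v\<close>, and for \<open>i = 0\<close> it is \<open>p v\<close>.  All
  these norms send \<open>v\<close> into \<open>D\<close>, hence so does \<open>p\<close>; as \<open>p\<close> is invertible, \<open>v \<in> D\<close>.\<close>

lemma unique_order_prime_subgroup_mod_kernel:
  assumes A: "subgroup A G" "comm_group (G\<lparr>carrier := A\<rparr>)"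
    and D: "stable_subspace A D" and v: "v \<in> carrier V" "v \<notin> D"
    and max: "\<And>E. \<lbrakk>stable_subspace A E; D \<subseteq> E; v \<notin> E\<rbrakk> \<Longrightarrow> E = D"
    and p: "Factorial_Ring.prime (p::nat)" "add_pow k p \<one>\<^bsub>k\<^esub> \<noteq> \<zero>\<^bsub>k\<^esub>"
    and x: "x \<in> A" "acts_trivially_mod D (x [^]\<^bsub>G\<^esub> p)"
    and y: "y \<in> A" "acts_trivially_mod D (y [^]\<^bsub>G\<^esub> p)" "\<not> acts_trivially_mod D y"
  obtains j :: nat where "acts_trivially_mod D (x \<otimes>\<^bsub>G\<^esub> y [^]\<^bsub>G\<^esub> j)"
proof (rule ccontr)
  assume "\<not> thesis"
  with that have nontriv: "\<not> acts_trivially_mod D (x \<otimes>\<^bsub>G\<^esub> y [^]\<^bsub>G\<^esub> j)" for j :: nat by blast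
  interpret A: subgroup A G by fact
  interpret GA: comm_group "G\<lparr>carrier := A\<rparr>" by fact
  have GA_pow: "a [^]\<^bsub>G\<lparr>carrier := A\<rparr>\<^esub> (i::nat) = a [^]\<^bsub>G\<^esub> i" for a i
    by (simp add: G.nat_pow_consistent[symmetric])
  let ?C = "{a \<in> A. acts_trivially_mod D a}"
  have C: "subgroup ?C (G\<lparr>carrier := A\<rparr>)" by (rule subgroup_acts_trivially_mod[OF A(1) D])
  interpret C: subgroup ?C "G\<lparr>carrier := A\<rparr>" by (rule C)
  have xy: "x \<in> carrier G" "y \<in> carrier G" using x(1) y(1) A.subset by auto
  have powA: "a [^]\<^bsub>G\<^esub> (i::nat) \<in> A" if "a \<in> A" for a i
    using GA.nat_pow_closed[of a i] that by (simp add: GA_pow)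
  have powC: "acts_trivially_mod D (a [^]\<^bsub>G\<^esub> (i::nat))" if "a \<in> A" "acts_trivially_mod D a" for a i
    using GA.subgroup_int_pow_closed[OF C, of a "int i"] that by (simp add: int_pow_int GA_pow)
  \<comment> \<open>The norm of \<open>x y\<^sup>j\<close>, an element whose \<open>p\<close>-th power \<open>x\<^sup>p (y\<^sup>p)\<^sup>j\<close> acts trivially modulo \<open>D\<close>.\<close>
  have row: "(\<Oplus>\<^bsub>V\<^esub>i\<in>{..<p}. gact ((x \<otimes>\<^bsub>G\<^esub> y [^]\<^bsub>G\<^esub> j) [^]\<^bsub>G\<^esub> i) v) \<in> D" for j :: nat
  proof (rule norm_in_maximal_stable[OF A D v(2) max])
    have "(x \<otimes>\<^bsub>G\<^esub> y [^]\<^bsub>G\<^esub> j) [^]\<^bsub>G\<^esub> p = x [^]\<^bsub>G\<^esub> p \<otimes>\<^bsub>G\<^esub> (y [^]\<^bsub>G\<^esub> p) [^]\<^bsub>G\<^esub> j"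
      using GA.nat_pow_distrib[of x "y [^]\<^bsub>G\<^esub> j" p] x(1) powA[OF y(1)] xy
      by (simp add: GA_pow G.nat_pow_pow mult.commute)
    then show "acts_trivially_mod D ((x \<otimes>\<^bsub>G\<^esub> y [^]\<^bsub>G\<^esub> j) [^]\<^bsub>G\<^esub> p)"
      using C.m_closed[of "x [^]\<^bsub>G\<^esub> p" "(y [^]\<^bsub>G\<^esub> p) [^]\<^bsub>G\<^esub> j"] x y powA powC by auto
  qed (use x(1) powA[OF y(1)] nontriv in auto)
  \<comment> \<open>The norm of \<open>y\<^sup>i\<close>, an element that acts nontrivially modulo \<open>D\<close> since \<open>i\<close> is prime to \<open>p\<close>.\<close>
  have col: "(\<Oplus>\<^bsub>V\<^esub>j\<in>{..<p}. gact ((y [^]\<^bsub>G\<^esub> i) [^]\<^bsub>G\<^esub> j) v) \<in> D" if i: "i \<in> {1..<p}" for i :: nat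
  proof (rule norm_in_maximal_stable[OF A D v(2) max])
    have "coprime i p" using i p(1)
      by (metis atLeastLessThan_iff coprime_commute nat_dvd_not_less less_le_trans prime_imp_coprime
          zero_less_one)
    then show "\<not> acts_trivially_mod D (y [^]\<^bsub>G\<^esub> i)"
      using GA.subgroup_mem_of_coprime_powers[OF C, of y i p] y powA by (auto simp: GA_pow)
    show "acts_trivially_mod D ((y [^]\<^bsub>G\<^esub> i) [^]\<^bsub>G\<^esub> p)"
      using powC[OF powA[OF y(1)] y(2), of i] xy by (simp add: G.nat_pow_pow mult.commute)
  qed (use powA[OF y(1)] in auto)
  define F where "F i j = gact ((x \<otimes>\<^bsub>G\<^esub> y [^]\<^bsub>G\<^esub> j) [^]\<^bsub>G\<^esub> i) v" for i j :: nat
  have F: "F i j \<in> carrier V" for i j using xy v by (simp add: F_def)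
  have F_eq: "F i j = gact (x [^]\<^bsub>G\<^esub> i) (gact ((y [^]\<^bsub>G\<^esub> i) [^]\<^bsub>G\<^esub> j) v)" for i j
    using GA.nat_pow_distrib[of x "y [^]\<^bsub>G\<^esub> j" i] x(1) powA[OF y(1)] xy v
    by (simp add: F_def GA_pow act_act G.nat_pow_pow mult.commute)
  have inner: "(\<Oplus>\<^bsub>V\<^esub>j\<in>{..<p}. F i j) \<in> D" if i: "i \<in> {1..<p}" for i
  proof -
    have "(\<Oplus>\<^bsub>V\<^esub>j\<in>{..<p}. F i j) =
        gact (x [^]\<^bsub>G\<^esub> i) (\<Oplus>\<^bsub>V\<^esub>j\<in>{..<p}. gact ((y [^]\<^bsub>G\<^esub> i) [^]\<^bsub>G\<^esub> j) v)"
      unfolding F_eq using xy v by (subst act_finsum) auto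
    then show ?thesis using stable_act[OF D _ powA[OF x(1)] col[OF i], of "\<one>\<^bsub>k\<^esub>"] by simp
  qed
  have total: "(\<Oplus>\<^bsub>V\<^esub>i\<in>{..<p}. \<Oplus>\<^bsub>V\<^esub>j\<in>{..<p}. F i j) \<in> D"
    by (subst V.finsum_swap[OF finite_lessThan finite_lessThan F],
        rule stable_finsum[OF D finite_lessThan]) (use row in \<open>simp add: F_def\<close>)
  let ?R = "\<Oplus>\<^bsub>V\<^esub>i\<in>{1..<p}. \<Oplus>\<^bsub>V\<^esub>j\<in>{..<p}. F i j"
  have R: "?R \<in> D" by (rule stable_finsum[OF D]) (use inner in auto)
  have "(\<Oplus>\<^bsub>V\<^esub>i\<in>insert 0 {1..<p}. \<Oplus>\<^bsub>V\<^esub>j\<in>{..<p}. F i j) = (\<Oplus>\<^bsub>V\<^esub>j\<in>{..<p}. F 0 j) \<oplus>\<^bsub>V\<^esub> ?R"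
    using F by (intro V.finsum_insert) (auto intro!: V.finsum_closed)
  moreover have "insert 0 {1..<p} = {..<p}" using prime_gt_0_nat[OF p(1)] by auto
  ultimately have "(\<Oplus>\<^bsub>V\<^esub>i\<in>{..<p}. \<Oplus>\<^bsub>V\<^esub>j\<in>{..<p}. F i j) = (\<Oplus>\<^bsub>V\<^esub>j\<in>{..<p}. F 0 j) \<oplus>\<^bsub>V\<^esub> ?R"
    by (simp only:)
  also have "(\<Oplus>\<^bsub>V\<^esub>j\<in>{..<p}. F 0 j) = add_pow V p v"
    using v by (simp add: F_def V.add.finprod_const)
  finally have "add_pow V p v = (\<Oplus>\<^bsub>V\<^esub>i\<in>{..<p}. \<Oplus>\<^bsub>V\<^esub>j\<in>{..<p}. F i j) \<ominus>\<^bsub>V\<^esub> ?R"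
    using R v stable_subset[OF D] by (auto simp: a_minus_def V.a_assoc V.r_neg)
  then have pv: "add_pow V p v \<in> D" using stable_minus[OF D total R] by simp
  let ?c = "add_pow k p \<one>\<^bsub>k\<^esub>"
  have c: "?c \<in> carrier k" "inv\<^bsub>k\<^esub> ?c \<in> carrier k" "inv\<^bsub>k\<^esub> ?c \<otimes>\<^bsub>k\<^esub> ?c = \<one>\<^bsub>k\<^esub>"
    using p(2) k.field_Units by auto
  have "v = act (inv\<^bsub>k\<^esub> ?c) \<one>\<^bsub>G\<^esub> (add_pow V p v)"
    using c v by (simp add: act_nat_scalar[symmetric] act_act)
  then show False using stable_act[OF D c(2) A.one_closed pv] v(2) by simp
qed

text \<open>The preceding lemma, read in the quotient: if \<open>\<xi> \<eta>\<^sup>j = 1\<close> then \<open>\<xi>\<close> is the inverse of \<open>\<eta>\<^sup>j\<close>,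
  and this is the power of \<open>\<eta>\<close> with exponent \<open>(p - 1)j\<close> because \<open>\<eta>\<^sup>p = 1\<close>.\<close>

lemma locally_cyclic_mod_acts_trivially:
  assumes A: "subgroup A G" "comm_group (G\<lparr>carrier := A\<rparr>)" "torsion_group (G\<lparr>carrier := A\<rparr>)"
    and char: "ring_char k \<notin> torsion_primes (G\<lparr>carrier := A\<rparr>)"
    and D: "stable_subspace A D" and v: "v \<in> carrier V" "v \<notin> D"
    and max: "\<And>E. \<lbrakk>stable_subspace A E; D \<subseteq> E; v \<notin> E\<rbrakk> \<Longrightarrow> E = D"
  shows "locally_cyclic ((G\<lparr>carrier := A\<rparr>) Mod {a \<in> A. acts_trivially_mod D a})"
proof -
  let ?A = "G\<lparr>carrier := A\<rparr>" and ?C = "{a \<in> A. acts_trivially_mod D a}"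
  interpret GA: comm_group ?A by fact
  have C: "subgroup ?C ?A" by (rule subgroup_acts_trivially_mod[OF A(1) D])
  interpret C: normal ?C ?A using GA.subgroup_imp_normal[OF C] .
  interpret Q: comm_group "?A Mod ?C" by (rule GA.abelian_FactGroup[OF C])
  have GA_pow: "a [^]\<^bsub>?A\<^esub> (i::nat) = a [^]\<^bsub>G\<^esub> i" for a i
    by (simp add: G.nat_pow_consistent[symmetric])
  have coset_pow: "(?C #>\<^bsub>?A\<^esub> a) [^]\<^bsub>?A Mod ?C\<^esub> (i::nat) = ?C #>\<^bsub>?A\<^esub> (a [^]\<^bsub>?A\<^esub> i)" if "a \<in> A" for a i
    using C.FactGroup_pow[of a i] that by simp
  have coset_one: "?C #>\<^bsub>?A\<^esub> a = ?C \<longleftrightarrow> a \<in> ?C" if "a \<in> A" for a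
    using GA.coset_join1[OF _ _ C, of a] GA.coset_join2[OF _ C, of a] that by auto
  show ?thesis
  proof (rule Q.locally_cyclic_if_unique_prime_order_subgroups)
    show "torsion_group (?A Mod ?C)"
      unfolding torsion_group_def
    proof (intro conjI ballI)
      fix \<xi> assume "\<xi> \<in> carrier (?A Mod ?C)"
      then obtain a where a: "a \<in> A" "\<xi> = ?C #>\<^bsub>?A\<^esub> a" by (auto simp: carrier_FactGroup)
      then obtain n :: nat where "n > 0" "a [^]\<^bsub>?A\<^esub> n = \<one>\<^bsub>?A\<^esub>"
        using A(3) by (auto simp: torsion_group_def)
      then show "\<exists>n::nat. n > 0 \<and> \<xi> [^]\<^bsub>?A Mod ?C\<^esub> n = \<one>\<^bsub>?A Mod ?C\<^esub>"
        using a coset_pow[OF a(1)] coset_one[of "\<one>\<^bsub>?A\<^esub>"] C.one_closed GA.one_closed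
        by (intro exI[of _ n]) auto
    qed (rule Q.is_group)
  next
    fix p :: nat and \<xi> \<eta>
    assume p: "Factorial_Ring.prime p" and "\<xi> \<in> carrier (?A Mod ?C)" "\<eta> \<in> carrier (?A Mod ?C)"
      and Xp: "\<xi> [^]\<^bsub>?A Mod ?C\<^esub> p = \<one>\<^bsub>?A Mod ?C\<^esub>" and Yp: "\<eta> [^]\<^bsub>?A Mod ?C\<^esub> p = \<one>\<^bsub>?A Mod ?C\<^esub>"
      and Y1: "\<eta> \<noteq> \<one>\<^bsub>?A Mod ?C\<^esub>"
    then obtain x y where x: "x \<in> A" "\<xi> = ?C #>\<^bsub>?A\<^esub> x" and y: "y \<in> A" "\<eta> = ?C #>\<^bsub>?A\<^esub> y"
      by (auto simp: carrier_FactGroup)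
    have XQ: "\<xi> \<in> carrier (?A Mod ?C)" and YQ: "\<eta> \<in> carrier (?A Mod ?C)" by fact+
    have xp: "x [^]\<^bsub>?A\<^esub> p \<in> ?C" and yp: "y [^]\<^bsub>?A\<^esub> p \<in> ?C"
      using Xp Yp x y coset_pow coset_one GA.nat_pow_closed[of x p] GA.nat_pow_closed[of y p] by auto
    have y1: "y \<notin> ?C" using Y1 y coset_one by auto
    have "p \<in> torsion_primes ?A"
      using torsion_prime_of_prime_root[OF A(3) C p _ y1 yp] y(1) by simp
    then have "add_pow k p \<one>\<^bsub>k\<^esub> \<noteq> \<zero>\<^bsub>k\<^esub>" using char k.prime_not_ring_char[OF p] by metis
    then obtain j :: nat where j: "acts_trivially_mod D (x \<otimes>\<^bsub>G\<^esub> y [^]\<^bsub>G\<^esub> j)"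
      using unique_order_prime_subgroup_mod_kernel[OF A(1,2) D v max p _ x(1) _ y(1)] xp yp y1 y(1)
      by (auto simp: GA_pow)
    have yj: "y [^]\<^bsub>?A\<^esub> j \<in> A" using GA.nat_pow_closed[of y j] y(1) by simp
    then have "x \<otimes>\<^bsub>?A\<^esub> y [^]\<^bsub>?A\<^esub> j \<in> ?C"
      using j GA.m_closed[of x "y [^]\<^bsub>?A\<^esub> j"] x(1) by (simp add: GA_pow)
    moreover have "\<xi> \<otimes>\<^bsub>?A Mod ?C\<^esub> \<eta> [^]\<^bsub>?A Mod ?C\<^esub> j = ?C #>\<^bsub>?A\<^esub> (x \<otimes>\<^bsub>?A\<^esub> y [^]\<^bsub>?A\<^esub> j)"
      using C.rcos_sum[of x "y [^]\<^bsub>?A\<^esub> j"] x y yj coset_pow by simp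
    ultimately have XY: "\<xi> \<otimes>\<^bsub>?A Mod ?C\<^esub> \<eta> [^]\<^bsub>?A Mod ?C\<^esub> j = \<one>\<^bsub>?A Mod ?C\<^esub>"
      using coset_one[of "x \<otimes>\<^bsub>?A\<^esub> y [^]\<^bsub>?A\<^esub> j"] by simp
    have "(p - 1) * j + j = p * j" using prime_gt_0_nat[OF p] by (cases p) auto
    then have "\<eta> [^]\<^bsub>?A Mod ?C\<^esub> ((p - 1) * j) \<otimes>\<^bsub>?A Mod ?C\<^esub> \<eta> [^]\<^bsub>?A Mod ?C\<^esub> j =
        (\<eta> [^]\<^bsub>?A Mod ?C\<^esub> p) [^]\<^bsub>?A Mod ?C\<^esub> j"
      using Q.nat_pow_mult[OF YQ] Q.nat_pow_pow[OF YQ] by metis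
    also have "\<dots> = \<xi> \<otimes>\<^bsub>?A Mod ?C\<^esub> \<eta> [^]\<^bsub>?A Mod ?C\<^esub> j"
      unfolding Yp XY by (rule Q.nat_pow_one)
    finally have "\<eta> [^]\<^bsub>?A Mod ?C\<^esub> ((p - 1) * j) = \<xi>"
      by (rule Q.r_cancel[OF _ Q.nat_pow_closed[OF YQ] XQ Q.nat_pow_closed[OF YQ]])
    from this[symmetric]
    show "\<exists>i::nat. \<xi> = \<eta> [^]\<^bsub>?A Mod ?C\<^esub> i" ..
  qed
qed

end

section \<open>Subgroups with locally cyclic quotient and trivial core\<close>

theorem theorem1p3:
  fixes k :: "('k, 'm) ring_scheme"
    and G :: "('g, 'n) monoid_scheme"
    and A :: "'g set"
    and V :: "('g \<Rightarrow> 'k, 'v, 'o) module_scheme"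
  assumes "field k"
    and "group G"
    and "subgroup A G"
    and "comm_group (G\<lparr>carrier := A\<rparr>)"
    and "torsion_group (G\<lparr>carrier := A\<rparr>)"
    and "ring_char k \<notin> torsion_primes (G\<lparr>carrier := A\<rparr>)"
    and "irreducible_module (group_algebra k G) V"
    and "faithful_module k G V"
  shows "\<exists>C. subgroup C (G\<lparr>carrier := A\<rparr>) \<and>
             locally_cyclic ((G\<lparr>carrier := A\<rparr>) Mod C) \<and>
             normal_core G C = {\<one>\<^bsub>G\<^esub>}"
proof -
  interpret group_algebra_module k G V
    using assms(1,2,7) by (simp add: group_algebra_module_def irreducible_module_def)
  interpret A: subgroup A G by fact
  obtain v where v: "v \<in> carrier V" "v \<noteq> \<zero>\<^bsub>V\<^esub>"
    using assms(7) V.zero_closed unfolding irreducible_module_def by blast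
  obtain D where D: "stable_subspace A D" "v \<notin> D"
      and max: "\<And>E. \<lbrakk>stable_subspace A E; D \<subseteq> E; v \<notin> E\<rbrakk> \<Longrightarrow> E = D"
    using maximal_stable_avoiding[OF A.subset A.one_closed v] by blast
  let ?C = "{a \<in> A. acts_trivially_mod D a}"
  have C: "subgroup ?C (G\<lparr>carrier := A\<rparr>)"
    by (rule subgroup_acts_trivially_mod[OF assms(3) D(1)])
  have "normal_core G ?C \<subseteq> {\<one>\<^bsub>G\<^esub>}"
  proof
    fix n assume n: "n \<in> normal_core G ?C"
    then have "n \<in> carrier G" using G.normal_core_subset[of ?C] A.subset by blast
    moreover have "group_elem k n \<odot>\<^bsub>V\<^esub> w = w" if "w \<in> carrier V" for w
      using core_acts_trivially[OF assms(7,3) D(1) _ n that] D(2) v(1)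
      by (auto simp: monomial_def group_elem_def)
    ultimately show "n \<in> {\<one>\<^bsub>G\<^esub>}" using assms(8) by (simp add: faithful_module_def)
  qed
  moreover have "\<one>\<^bsub>G\<^esub> \<in> normal_core G ?C"
  proof -
    have "\<one>\<^bsub>G\<^esub> \<in> ?C" using subgroup.one_closed[OF C] by simp
    then show ?thesis
      by (rule G.one_in_normal_core)
  qed
  ultimately have "normal_core G ?C = {\<one>\<^bsub>G\<^esub>}" by blast
  then show ?thesis
    using C locally_cyclic_mod_acts_trivially[OF assms(3-6) D(1) v(1) D(2) max] by blast
qed

end
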